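(* The maps $\mathcal I_1: Form_{RatLuk}\to Form_{\mathcal Q}$ and $\mathcal I_2: Form_{\mathcal Q}\to Form_{RatLuk}$ define two faithful translations of one logic into the other: for every $\varphi\in Form_{RatLuk}$, $\varphi$ is a theorem of Rational Łukasiewicz logic if and only if $\mathcal I_1(\varphi)$ is a theorem of $\mathcal Q$Ł, and for every $\psi\in Form_{\mathcal Q}$, $\psi$ is a theorem of $\mathcal Q$Ł if and only if $\mathcal I_2(\psi)$ is a theorem of Rational Łukasiewicz logic.
   Context: Let $[0,1]_{\mathbb Q}=[0,1]\cap\mathbb Q$, with $r\odot q^*=\max\{0,r-q\}$. Łukasiewicz logic has primitive connectives $\neg,\to$; put $\varphi\oplus\psi:=\neg\varphi\to\psi$ and $\varphi\vee\psi:=(\varphi\to\psi)\to\psi$. Its axioms are (L1) $\varphi\to(\psi\to\varphi)$; (L2) $(\varphi\to\psi)\to((\psi\to\chi)\to(\varphi\to\chi))$; (L3) $(\varphi\vee\psi)\to(\psi\vee\varphi)$; (L4) $(\neg\psi\to\neg\varphi)\to(\varphi\to\psi)$. The logic $\mathcal Q$Ł (formulas $Form_{\mathcal Q}$) adds to Łukasiewicz logic a unary connective $\nabla_r$ for each $r\in[0,1]_{\mathbb Q}$. Its axioms are (L1)–(L4) together with (Q1) $\nabla_r(\varphi\to\psi)\leftrightarrow(\nabla_r\varphi\to\nabla_r\psi)$; (Q2) $\nabla_{(r\odot q^* )}\varphi\leftrightarrow(\nabla_q\varphi\to\nabla_r\varphi)$; (Q3) $\nabla_r(\nabla_q\varphi)\leftrightarrow\nabla_{r\cdot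 q}\varphi$; (Q4) $\nabla_1\varphi\leftrightarrow\varphi$ (each $\leftrightarrow$ stands for both implications). The only rule is modus ponens. Put $\Delta_r:=\neg\nabla_r\neg$; for the translations, formulas of $\mathcal Q$Ł are regarded as built with $\Delta_r$ as the primitive connective (so $\nabla_r=\neg\Delta_r\neg$). Rational Łukasiewicz logic (formulas $Form_{RatLuk}$) adds to Łukasiewicz logic unary connectives $\delta_n$, $n\ge1$. Its axioms are (L1)–(L4) together with (D1) $n(\delta_n\varphi)\to\varphi$; (D2) $\varphi\to n(\delta_n\varphi)$; (D3) $\neg\delta_n\varphi\oplus\neg((n-1)\delta_n\varphi)$, where $k\theta$ denotes $\theta\oplus\dots\oplus\theta$ ($k$ times), and the empty sum ($k=0$) is a falsum formula $\neg(p\to p)$. The only rule is modus ponens. Translations: $\mathcal I_1$ and $\mathcal I_2$ are the identity on propositional variables and commute with $\neg$ and $\to$; moreover $\mathcal I_1(\delta_n\varphi)=\Delta_{\frac1n}\mathcal I_1(\varphi)$, and, for $r=\frac mn$ (a fixed fractional representation with $0\le m\le n$, $n\ge1$), $\mathcal I_2(\Delta_r\varphi)=m\,(\delta_n\mathcal I_2(\varphi))$. *)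

theory Defs
  imports Complex_Main
begin

section \<open>Index types\<close>

text \<open>The rational unit interval and the positive integers.\<close>

typedef unit_rat = "{r :: rat. 0 \<le> r \<and> r \<le> 1}"
  morphisms rat_of_unit Unit
  by (rule exI[of _ 0]) simp

typedef pos_nat = "{n :: nat. 1 \<le> n}"
  morphisms nat_of_pos Pos
  by (rule exI[of _ 1]) simp

setup_lifting type_definition_unit_rat
setup_lifting type_definition_pos_nat

lift_definition unit_one :: unit_rat is "1 :: rat" by simp

lift_definition unit_times :: "unit_rat \<Rightarrow> unit_rat \<Rightarrow> unit_rat" is "\<lambda>r q. r * q"
  by (simp add: mult_le_one)

text \<open>Truncated difference \<open>r \<odot> q\<^sup>* = max {0, r - q}\<close>.\<close>

lift_definition unit_tdiff :: "unit_rat \<Rightarrow> unit_rat \<Rightarrow> unit_rat" is "\<lambda>r q. max 0 (r - q)"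
  by auto

lift_definition unit_recip :: "pos_nat \<Rightarrow> unit_rat" is "\<lambda>n. 1 / of_nat n"
  by simp

section \<open>Formulas over a family of additional unary connectives\<close>

text \<open>The type variable \<open>'c\<close> is the index set of the unary connectives that are added to
  Lukasiewicz logic.\<close>

datatype 'c fm =
    Var nat
  | Neg "'c fm"  (\<open>\<^bold>\<not> _\<close> [80] 80)
  | Imp "'c fm" "'c fm"  (infixr \<open>\<^bold>\<rightarrow>\<close> 55)
  | Con 'c "'c fm"

definition Oplus :: "'c fm \<Rightarrow> 'c fm \<Rightarrow> 'c fm"  (infixr \<open>\<^bold>\<oplus>\<close> 65) where
  "\<phi> \<^bold>\<oplus> \<psi> = \<^bold>\<not> \<phi> \<^bold>\<rightarrow> \<psi>"

definition Disj :: "'c fm \<Rightarrow> 'c fm \<Rightarrow> 'c fm"  (infixr \<open>\<^bold>\<or>\<close> 60) where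
  "\<phi> \<^bold>\<or> \<psi> = (\<phi> \<^bold>\<rightarrow> \<psi>) \<^bold>\<rightarrow> \<psi>"

definition Falsum :: "'c fm" where
  "Falsum = \<^bold>\<not> (Var 0 \<^bold>\<rightarrow> Var 0)"

text \<open>The sum of \<open>k\<close> copies of a formula; for \<open>k = 1\<close> it is the formula itself, not
  its sum with \<open>Falsum\<close>.\<close>

fun nsum :: "nat \<Rightarrow> 'c fm \<Rightarrow> 'c fm" where
  "nsum 0 \<theta> = Falsum"
| "nsum (Suc 0) \<theta> = \<theta>"
| "nsum (Suc (Suc k)) \<theta> = \<theta> \<^bold>\<oplus> nsum (Suc k) \<theta>"

section \<open>Axioms and theorems\<close>

inductive luk_ax :: "'c fm \<Rightarrow> bool" where
  L1: "luk_ax (\<phi> \<^bold>\<rightarrow> (\<psi> \<^bold>\<rightarrow> \<phi>))"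
| L2: "luk_ax ((\<phi> \<^bold>\<rightarrow> \<psi>) \<^bold>\<rightarrow> ((\<psi> \<^bold>\<rightarrow> \<chi>) \<^bold>\<rightarrow> (\<phi> \<^bold>\<rightarrow> \<chi>)))"
| L3: "luk_ax ((\<phi> \<^bold>\<or> \<psi>) \<^bold>\<rightarrow> (\<psi> \<^bold>\<or> \<phi>))"
| L4: "luk_ax ((\<^bold>\<not> \<psi> \<^bold>\<rightarrow> \<^bold>\<not> \<phi>) \<^bold>\<rightarrow> (\<phi> \<^bold>\<rightarrow> \<psi>))"

inductive derivable :: "('c fm \<Rightarrow> bool) \<Rightarrow> 'c fm \<Rightarrow> bool" for Ax where
  axm: "Ax \<phi> \<Longrightarrow> derivable Ax \<phi>"
| mp: "derivable Ax (\<phi> \<^bold>\<rightarrow> \<psi>) \<Longrightarrow> derivable Ax \<phi> \<Longrightarrow> derivable Ax \<psi>"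

subsection \<open>The logic with the connectives \<open>\<nabla>\<^sub>r\<close>\<close>

datatype nabla_con = NablaC unit_rat

type_synonym q_fm = "nabla_con fm"

abbreviation Nabla :: "unit_rat \<Rightarrow> q_fm \<Rightarrow> q_fm" where
  "Nabla r \<phi> \<equiv> Con (NablaC r) \<phi>"

definition Delta :: "unit_rat \<Rightarrow> q_fm \<Rightarrow> q_fm" where
  "Delta r \<phi> = \<^bold>\<not> Nabla r (\<^bold>\<not> \<phi>)"

inductive q_ax :: "q_fm \<Rightarrow> bool" where
  luk: "luk_ax \<phi> \<Longrightarrow> q_ax \<phi>"
| Q1a: "q_ax (Nabla r (\<phi> \<^bold>\<rightarrow> \<psi>) \<^bold>\<rightarrow> (Nabla r \<phi> \<^bold>\<rightarrow> Nabla r \<psi>))"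
| Q1b: "q_ax ((Nabla r \<phi> \<^bold>\<rightarrow> Nabla r \<psi>) \<^bold>\<rightarrow> Nabla r (\<phi> \<^bold>\<rightarrow> \<psi>))"
| Q2a: "q_ax (Nabla (unit_tdiff r q) \<phi> \<^bold>\<rightarrow> (Nabla q \<phi> \<^bold>\<rightarrow> Nabla r \<phi>))"
| Q2b: "q_ax ((Nabla q \<phi> \<^bold>\<rightarrow> Nabla r \<phi>) \<^bold>\<rightarrow> Nabla (unit_tdiff r q) \<phi>)"
| Q3a: "q_ax (Nabla r (Nabla q \<phi>) \<^bold>\<rightarrow> Nabla (unit_times r q) \<phi>)"
| Q3b: "q_ax (Nabla (unit_times r q) \<phi> \<^bold>\<rightarrow> Nabla r (Nabla q \<phi>))"
| Q4a: "q_ax (Nabla unit_one \<phi> \<^bold>\<rightarrow> \<phi>)"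
| Q4b: "q_ax (\<phi> \<^bold>\<rightarrow> Nabla unit_one \<phi>)"

abbreviation q_theorem :: "q_fm \<Rightarrow> bool" where
  "q_theorem \<equiv> derivable q_ax"

subsection \<open>Rational Lukasiewicz logic\<close>

datatype div_con = DivC pos_nat

type_synonym rat_fm = "div_con fm"

abbreviation Div :: "pos_nat \<Rightarrow> rat_fm \<Rightarrow> rat_fm" where
  "Div n \<phi> \<equiv> Con (DivC n) \<phi>"

inductive rat_ax :: "rat_fm \<Rightarrow> bool" where
  luk: "luk_ax \<phi> \<Longrightarrow> rat_ax \<phi>"
| D1: "rat_ax (nsum (nat_of_pos n) (Div n \<phi>) \<^bold>\<rightarrow> \<phi>)"
| D2: "rat_ax (\<phi> \<^bold>\<rightarrow> nsum (nat_of_pos n) (Div n \<phi>))"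
| D3: "rat_ax (\<^bold>\<not> Div n \<phi> \<^bold>\<oplus> \<^bold>\<not> nsum (nat_of_pos n - 1) (Div n \<phi>))"

abbreviation rat_theorem :: "rat_fm \<Rightarrow> bool" where
  "rat_theorem \<equiv> derivable rat_ax"

section \<open>Presentation with \<open>\<Delta>\<^sub>r\<close> as the primitive connective\<close>

text \<open>The axioms speak about \<open>\<nabla>\<^sub>r\<close>, the translations about \<open>\<Delta>\<^sub>r\<close>.  A formula with
  primitive \<open>\<Delta>\<^sub>r\<close> denotes the formula in which every \<open>\<Delta>\<^sub>r\<close> is unfolded to
  \<open>\<not> \<nabla>\<^sub>r \<not>\<close>; it counts as a theorem iff its unfolding is one.  (Reading the axioms directly
  over primitive \<open>\<Delta>\<^sub>r\<close> with \<open>\<nabla>\<^sub>r = \<not> \<Delta>\<^sub>r \<not>\<close> would give a weaker system: no axiom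
  would constrain \<open>\<Delta>\<^sub>r \<phi>\<close> for \<open>\<phi>\<close> not syntactically a negation.)\<close>

datatype delta_con = DeltaC unit_rat

type_synonym qd_fm = "delta_con fm"

primrec unfold_delta :: "qd_fm \<Rightarrow> q_fm" where
  "unfold_delta (Var p) = Var p"
| "unfold_delta (\<^bold>\<not> \<phi>) = \<^bold>\<not> unfold_delta \<phi>"
| "unfold_delta (\<phi> \<^bold>\<rightarrow> \<psi>) = unfold_delta \<phi> \<^bold>\<rightarrow> unfold_delta \<psi>"
| "unfold_delta (Con c \<phi>) = (case c of DeltaC r \<Rightarrow> Delta r (unfold_delta \<phi>))"

text \<open>Conversely, a formula with primitive \<open>\<nabla>\<^sub>r\<close> is regarded as built with \<open>\<Delta>\<^sub>r\<close> by
  reading \<open>\<nabla>\<^sub>r\<close> as \<open>\<not> \<Delta>\<^sub>r \<not>\<close>.\<close>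

primrec regard_delta :: "q_fm \<Rightarrow> qd_fm" where
  "regard_delta (Var p) = Var p"
| "regard_delta (\<^bold>\<not> \<phi>) = \<^bold>\<not> regard_delta \<phi>"
| "regard_delta (\<phi> \<^bold>\<rightarrow> \<psi>) = regard_delta \<phi> \<^bold>\<rightarrow> regard_delta \<psi>"
| "regard_delta (Con c \<phi>) =
     (case c of NablaC r \<Rightarrow> \<^bold>\<not> Con (DeltaC r) (\<^bold>\<not> regard_delta \<phi>))"

section \<open>The translations\<close>

primrec I1 :: "rat_fm \<Rightarrow> qd_fm" where
  "I1 (Var p) = Var p"
| "I1 (\<^bold>\<not> \<phi>) = \<^bold>\<not> I1 \<phi>"
| "I1 (\<phi> \<^bold>\<rightarrow> \<psi>) = I1 \<phi> \<^bold>\<rightarrow> I1 \<psi>"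
| "I1 (Con c \<phi>) = (case c of DivC n \<Rightarrow> Con (DeltaC (unit_recip n)) (I1 \<phi>))"

text \<open>A fixed choice of a fractional representation \<open>r = m / n\<close> for every index \<open>r\<close>; it
  need not be in lowest terms.\<close>

definition frac_rep :: "(unit_rat \<Rightarrow> nat \<times> pos_nat) \<Rightarrow> bool" where
  "frac_rep rep \<longleftrightarrow> (\<forall>r. case rep r of (m, n) \<Rightarrow>
     m \<le> nat_of_pos n \<and> rat_of_unit r = of_nat m / of_nat (nat_of_pos n))"

primrec I2 :: "(unit_rat \<Rightarrow> nat \<times> pos_nat) \<Rightarrow> qd_fm \<Rightarrow> rat_fm" where
  "I2 rep (Var p) = Var p"
| "I2 rep (\<^bold>\<not> \<phi>) = \<^bold>\<not> I2 rep \<phi>"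
| "I2 rep (\<phi> \<^bold>\<rightarrow> \<psi>) = I2 rep \<phi> \<^bold>\<rightarrow> I2 rep \<psi>"
| "I2 rep (Con c \<phi>) =
     (case c of DeltaC r \<Rightarrow> case rep r of (m, n) \<Rightarrow> nsum m (Div n (I2 rep \<phi>)))"

end

theory Submission
  imports Defs "HOL-Library.Multiset"
begin

text \<open>Both logics are sound and complete for valuations in \<open>[0,1]\<close> with \<open>\<delta>\<^sub>n x = x / n\<close> and
  \<open>\<nabla>\<^sub>r x = 1 - r (1 - x)\<close>, that is \<open>\<Delta>\<^sub>r x = r x\<close>, and the translations preserve values.
  Finitely many instances of (D1)-(D3), respectively of (Q2) and (Q4), already force an
  additional connective to take its standard value on a given formula, so completeness reduces to
  that of Lukasiewicz logic for finite sets of premises. A non-derivable formula is refuted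
  in a linearly ordered algebra, which embeds into the unit interval of a linearly ordered abelian
  group; the finitely many order relations between integer combinations of the values of its
  subformulas can then be realized by real numbers.\<close>

section \<open>Total cones of integer linear forms\<close>

text \<open>The obstacle is that a linearly ordered algebra may contain infinitesimals, so it need
  not embed into the reals; for infinite sets of premises completeness over \<open>[0,1]\<close>
  even fails. Hence only finitely many comparisons are transferred, and the reals for them come from
  Fourier-Motzkin elimination instead of an embedding. The group around the algebra enters only
  through translations by elements of the algebra: comparing words in commuting translations gives a
  total additive set of integer linear forms, on which the elimination operates. Formulas headed by
  an additional connective are atoms for the Lukasiewicz part; the forcing instances then tie down
  their values. The translations never have to be followed through derivations, since equality of
  values yields both directions of faithfulness.\<close>

lemma cone_scale:
  fixes P :: "('i \<Rightarrow> int) \<Rightarrow> bool"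
  assumes add: "\<And>f g. P f \<Longrightarrow> P g \<Longrightarrow> P (\<lambda>i. f i + g i)"
    and "P f" and "0 < m"
  shows "P (\<lambda>i. m * f i)"
  using \<open>0 < m\<close>
proof (induction m rule: int_gr_induct)
  case base
  then show ?case using \<open>P f\<close> by simp
next
  case (step m)
  then show ?case using add[of "\<lambda>i. m * f i" f] \<open>P f\<close> by (simp add: algebra_simps)
qed

lemma real_between_finite:
  fixes L U :: "real set"
  assumes "finite L" "finite U" and lt: "\<And>l u. l \<in> L \<Longrightarrow> u \<in> U \<Longrightarrow> l < u"
  shows "\<exists>t. (\<forall>l\<in>L. l < t) \<and> (\<forall>u\<in>U. t < u)"
proof (cases "L = {} \<or> U = {}")
  case True
  moreover have "\<exists>t. \<forall>l\<in>L. l < t"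
    using bdd_above_finite[OF \<open>finite L\<close>]
    by (metis bdd_above_def gt_ex le_less_trans)
  moreover have "\<exists>t. \<forall>u\<in>U. t < u"
    using bdd_below_finite[OF \<open>finite U\<close>]
    by (metis bdd_below_def lt_ex less_le_trans)
  ultimately show ?thesis by auto
next
  case False
  then have "Max L < Min U"
    using lt assms by (meson Max_in Min_in)
  then obtain t where "Max L < t" "t < Min U"
    using dense by blast
  then show ?thesis
    using assms False by auto
qed

text \<open>Fourier-Motzkin elimination. A form \<open>f\<close> whose coefficient at \<open>z\<close> is positive bounds the
  new coordinate by \<open>\<tau> f\<close>, from below if \<open>f\<close> lies in the cone and from above if \<open>- f\<close> does; the
  eliminants \<open>g z * f - f z * g\<close> decide how these bounds compare.\<close>

lemma cone_realizable:
  fixes P :: "('i \<Rightarrow> int) \<Rightarrow> bool"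
  assumes "finite X" and "finite C"
    and "\<And>f i. f \<in> C \<Longrightarrow> i \<notin> X \<Longrightarrow> f i = 0"
    and add: "\<And>f g. P f \<Longrightarrow> P g \<Longrightarrow> P (\<lambda>i. f i + g i)"
    and total: "\<And>f. (\<And>i. i \<notin> X \<Longrightarrow> f i = 0) \<Longrightarrow> P f \<or> P (\<lambda>i. - f i)"
  shows "\<exists>v :: 'i \<Rightarrow> real. \<forall>f\<in>C. P f \<longleftrightarrow> 0 \<le> (\<Sum>i\<in>X. of_int (f i) * v i)"
  using \<open>finite X\<close> \<open>finite C\<close> assms(3) total
proof (induction X arbitrary: C rule: finite_induct)
  case empty
  have "P (\<lambda>i. 0)"
    using empty.prems(3)[of "\<lambda>i. 0"] by simp
  moreover have "f = (\<lambda>i. 0)" if "f \<in> C" for f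
    using empty.prems(2)[OF that] by auto
  ultimately show ?case by auto
next
  case (insert z X)
  note total = insert.prems(3)
  have P0: "P (\<lambda>i. 0)"
    using total[of "\<lambda>i. 0"] by simp
  define el where "el f g = (\<lambda>i. g z * f i - f z * g i)" for f g :: "'i \<Rightarrow> int"
  \<comment> \<open>Closing \<open>C\<close> under negation reduces negative coefficients at
    \<open>z\<close> to positive ones.\<close>
  define D where "D = C \<union> (\<lambda>f i. - f i) ` C"
  define E where "E = {f \<in> D. f z = 0} \<union> (\<lambda>(f, g). el f g) ` (D \<times> D)"
  have supp: "f i = 0" if "f \<in> D" "i \<notin> insert z X" for f i
    using that insert.prems(2) by (auto simp: D_def)
  have finD: "finite D" using insert.prems(1) by (simp add: D_def)
  have "\<exists>v :: 'i \<Rightarrow> real. \<forall>f\<in>E. P f \<longleftrightarrow> 0 \<le> (\<Sum>i\<in>X. of_int (f i) * v i)"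
  proof (rule insert.IH)
    show "finite E" using finD by (simp add: E_def)
    show "f i = 0" if "f \<in> E" "i \<notin> X" for f i
    proof (cases "i = z")
      case True
      then show ?thesis using that by (auto simp: E_def el_def)
    next
      case False
      then have zero: "h i = 0" if "h \<in> D" for h using supp that \<open>i \<notin> X\<close> by simp
      from that consider "f \<in> D" | g h where "g \<in> D" "h \<in> D" "f = el g h"
        by (auto simp: E_def)
      then show ?thesis by cases (simp_all add: el_def zero)
    qed
    show "P f \<or> P (\<lambda>i. - f i)" if "\<And>i. i \<notin> X \<Longrightarrow> f i = 0" for f
      using total that by auto
  qed
  then obtain v :: "'i \<Rightarrow> real"
    where v: "\<And>f. f \<in> E \<Longrightarrow> P f \<longleftrightarrow> 0 \<le> (\<Sum>i\<in>X. of_int (f i) * v i)" by blast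
  define S where "S f = (\<Sum>i\<in>X. of_int (f i) * v i)" for f :: "'i \<Rightarrow> int"
  define \<tau> where "\<tau> f = - S f / of_int (f z)" for f
  define D' where "D' = {f \<in> D. 0 < f z}"
  define lo where "lo f \<longleftrightarrow> P f" for f
  define hi where "hi f \<longleftrightarrow> P (\<lambda>i. - f i)" for f
  have lo_scale: "P (\<lambda>i. m * f i)" if "lo f" "0 < m" for f m
    by (rule cone_scale[where P = P and f = f]) (use that add in \<open>auto simp: lo_def\<close>)
  have hi_scale: "P (\<lambda>i. m * - f i)" if "hi f" "0 < m" for f m
    by (rule cone_scale[where P = P and f = "\<lambda>i. - f i"]) (use that add in \<open>auto simp: hi_def\<close>)
  have S_el: "S (el f g) = of_int (g z) * S f - of_int (f z) * S g" for f g
    by (simp add: S_def el_def sum_distrib_left left_diff_distrib sum_subtractf mult.assoc)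
  have el_tau: "0 \<le> S (el f g) \<longleftrightarrow> \<tau> f \<le> \<tau> g" if "f \<in> D'" "g \<in> D'" for f g
    using that unfolding S_el \<tau>_def D'_def by (simp add: field_simps)
  have lo_hi: "lo f \<or> hi f" if "f \<in> D'" for f
    using total[of f] supp that by (auto simp: lo_def hi_def D'_def)
  have Pel: "P (el f g) \<longleftrightarrow> \<tau> f \<le> \<tau> g" if "f \<in> D'" "g \<in> D'" for f g
    using v[of "el f g"] that el_tau[OF that] by (auto simp: E_def S_def D'_def)
  have le: "\<tau> f \<le> \<tau> g" if "f \<in> D'" "g \<in> D'" "lo f" "hi g" for f g
  proof -
    have "P (\<lambda>i. g z * f i)" "P (\<lambda>i. f z * - g i)"
      using that by (intro lo_scale hi_scale; simp add: D'_def)+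
    from add[OF this] show ?thesis
      using Pel[OF that(1,2)] by (simp add: el_def)
  qed
  have le_hi: "hi f" if "f \<in> D'" "g \<in> D'" "hi g" "\<tau> g \<le> \<tau> f" for f g
  proof (rule ccontr)
    assume "\<not> hi f"
    have pel: "P (el g f)"
      using Pel that by simp
    have "P (\<lambda>i. g z * - f i)"
    proof -
      have "P (\<lambda>i. f z * - g i)"
        using that by (intro hi_scale) (auto simp: D'_def)
      from add[OF pel this] show ?thesis by (simp add: el_def)
    qed
    \<comment> \<open>The cone is closed under addition, not under division by \<open>g z\<close>.
      By totality \<open>f\<close> lies in it, and adding \<open>g z - 1\<close> copies of
      \<open>f\<close> turns \<open>g z * (- f)\<close> into \<open>- f\<close>.\<close>
    moreover have "P (\<lambda>i. (g z - 1) * f i)"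
    proof (cases "g z = 1")
      case True
      then show ?thesis using P0 by simp
    next
      case False
      then show ?thesis
        using that \<open>\<not> hi f\<close> lo_hi by (intro lo_scale) (auto simp: D'_def)
    qed
    ultimately have "P (\<lambda>i. g z * - f i + (g z - 1) * f i)"
      by (rule add)
    then have "hi f" by (simp add: hi_def algebra_simps)
    with \<open>\<not> hi f\<close> show False by simp
  qed
  have le_lo: "lo g" if "f \<in> D'" "g \<in> D'" "lo f" "\<tau> g \<le> \<tau> f" for f g
  proof (rule ccontr)
    assume "\<not> lo g"
    have pel: "P (el g f)"
      using Pel that by simp
    have "P (\<lambda>i. f z * g i)"
    proof -
      have "P (\<lambda>i. g z * f i)"
        using that by (intro lo_scale) (auto simp: D'_def)
      from add[OF pel this] show ?thesis by (simp add: el_def)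
    qed
    moreover have "P (\<lambda>i. (f z - 1) * - g i)"
    proof (cases "f z = 1")
      case True
      then show ?thesis using P0 by simp
    next
      case False
      then show ?thesis
        using that \<open>\<not> lo g\<close> lo_hi by (intro hi_scale) (auto simp: D'_def)
    qed
    ultimately have "P (\<lambda>i. f z * g i + (f z - 1) * - g i)"
      by (rule add)
    then have "lo g" by (simp add: lo_def algebra_simps)
    with \<open>\<not> lo g\<close> show False by simp
  qed
  have "\<exists>t. \<forall>f\<in>D'. (lo f \<longleftrightarrow> \<tau> f \<le> t) \<and> (hi f \<longleftrightarrow> t \<le> \<tau> f)"
  \<comment> \<open>A form that is \<open>lo\<close> and \<open>hi\<close> must get the value 0,
    which pins the new coordinate to its \<open>\<tau>\<close>. If there is none, all bounds are
    strict and any point between them will do.\<close>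
  proof (cases "\<exists>f\<in>D'. lo f \<and> hi f")
    case True
    then obtain f where "f \<in> D'" "lo f" "hi f" by blast
    then show ?thesis
      using le le_hi le_lo by (intro exI[of _ "\<tau> f"]) blast
  next
    case False
    have "\<exists>t. (\<forall>l\<in>\<tau> ` {f \<in> D'. lo f}. l < t) \<and> (\<forall>u\<in>\<tau> ` {f \<in> D'. hi f}. t < u)"
    proof (rule real_between_finite)
      show "l < u" if l: "l \<in> \<tau> ` {f \<in> D'. lo f}" and u: "u \<in> \<tau> ` {f \<in> D'. hi f}" for l u
      proof (rule ccontr)
        assume "\<not> l < u"
        then obtain f g where "f \<in> D'" "lo f" "g \<in> D'" "hi g" "\<tau> g \<le> \<tau> f"
          using l u by auto
        then show False using le_hi False by blast
      qed
    qed (use finD in \<open>auto simp: D'_def\<close>)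
    then obtain t where between: "\<forall>l\<in>\<tau> ` {f \<in> D'. lo f}. l < t" "\<forall>u\<in>\<tau> ` {f \<in> D'. hi f}. t < u"
      by (elim exE conjE)
    have t: "lo f \<Longrightarrow> \<tau> f < t" "hi f \<Longrightarrow> t < \<tau> f" if "f \<in> D'" for f
      using between that by simp_all
    have "(lo f \<longleftrightarrow> \<tau> f \<le> t) \<and> (hi f \<longleftrightarrow> t \<le> \<tau> f)" if "f \<in> D'" for f
      using t[OF that] lo_hi[OF that] by (auto simp: not_le dest: less_imp_le)
    then show ?thesis by blast
  qed
  then obtain t where t: "\<And>f. f \<in> D' \<Longrightarrow> (lo f \<longleftrightarrow> \<tau> f \<le> t) \<and> (hi f \<longleftrightarrow> t \<le> \<tau> f)" by blast
  have sum_v: "(\<Sum>i\<in>insert z X. of_int (f i) * (v(z := t)) i) = of_int (f z) * t + S f" for f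
  proof -
    have "(\<Sum>i\<in>X. of_int (f i) * (v(z := t)) i) = S f"
      unfolding S_def using insert.hyps by (intro sum.cong) auto
    then show ?thesis using insert.hyps by simp
  qed
  have "P f \<longleftrightarrow> 0 \<le> of_int (f z) * t + S f" if "f \<in> C" for f
  proof -
    consider "f z = 0" | "0 < f z" | "f z < 0" by linarith
    then show ?thesis
    proof cases
      case 1
      then have "f \<in> E" using that by (auto simp: E_def D_def)
      then show ?thesis using v[of f] 1 by (simp add: S_def)
    next
      case 2
      then have "f \<in> D'" using that by (auto simp: D'_def D_def)
      then show ?thesis using t[of f] 2 by (simp add: lo_def \<tau>_def field_simps) linarith
    next
      case 3
      then have "(\<lambda>i. - f i) \<in> D'" using that by (auto simp: D'_def D_def)
      moreover have "S (\<lambda>i. - f i) = - S f" by (simp add: S_def sum_negf)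
      ultimately show ?thesis using t[of "\<lambda>i. - f i"] 3 by (simp add: hi_def \<tau>_def field_simps) linarith
    qed
  qed
  then show ?case
    using sum_v by (intro exI[of _ "v(z := t)"]) simp
qed

section \<open>Commuting order automorphisms\<close>

text \<open>This stands in for a linearly ordered abelian group: only translations by generators are
  given, acting on a preordered set with a base point. Commutation is asked up to the preorder;
  exchanging \<open>x\<close> and \<open>x'\<close> gives the converse inequality.\<close>

locale commuting_shifts =
  fixes le :: "'g \<Rightarrow> 'g \<Rightarrow> bool" and S :: "'g set" and t :: "'x \<Rightarrow> 'g \<Rightarrow> 'g" and base :: 'g
  assumes le_total: "u \<in> S \<Longrightarrow> w \<in> S \<Longrightarrow> le u w \<or> le w u"
    and le_trans: "u \<in> S \<Longrightarrow> w \<in> S \<Longrightarrow> y \<in> S \<Longrightarrow> le u w \<Longrightarrow> le w y \<Longrightarrow> le u y"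
    and shift_in: "u \<in> S \<Longrightarrow> t x u \<in> S"
    and shift_le: "u \<in> S \<Longrightarrow> w \<in> S \<Longrightarrow> le (t x u) (t x w) \<longleftrightarrow> le u w"
    and shift_commute: "u \<in> S \<Longrightarrow> le (t x (t x' u)) (t x' (t x u))"
    and base_in: "base \<in> S"
begin

lemma le_refl: "u \<in> S \<Longrightarrow> le u u"
  using le_total by blast

lemma foldr_in: "u \<in> S \<Longrightarrow> foldr t xs u \<in> S"
  by (induction xs) (auto intro: shift_in)

lemma foldr_le: "u \<in> S \<Longrightarrow> w \<in> S \<Longrightarrow> le (foldr t xs u) (foldr t xs w) \<longleftrightarrow> le u w"
  by (induction xs) (auto simp: shift_le foldr_in)

lemma foldr_commute1:
  assumes "u \<in> S"
  shows "le (foldr t xs (t x u)) (t x (foldr t xs u)) \<and> le (t x (foldr t xs u)) (foldr t xs (t x u))"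
proof (induction xs)
  case Nil
  then show ?case by (simp add: le_refl shift_in assms)
next
  case (Cons y xs)
  have "le (t y (foldr t xs (t x u))) (t y (t x (foldr t xs u)))"
    "le (t y (t x (foldr t xs u))) (t y (foldr t xs (t x u)))"
    using Cons by (simp_all add: shift_le shift_in foldr_in assms)
  moreover have "le (t y (t x (foldr t xs u))) (t x (t y (foldr t xs u)))"
    "le (t x (t y (foldr t xs u))) (t y (t x (foldr t xs u)))"
    by (simp_all add: shift_commute foldr_in assms)
  ultimately show ?case
    by (simp, meson le_trans shift_in foldr_in assms)
qed

lemma foldr_mset_le:
  assumes "u \<in> S" "mset xs = mset ys"
  shows "le (foldr t xs u) (foldr t ys u)"
  using assms(2)
proof (induction xs arbitrary: ys)
  case Nil
  then show ?case by (simp add: le_refl assms)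
next
  case (Cons x xs)
  then have "x \<in> set ys"
    by (metis list.set_intros(1) set_mset_mset)
  then obtain ys1 ys2 where ys: "ys = ys1 @ x # ys2"
    by (meson split_list)
  with Cons.prems have "mset xs = mset (ys1 @ ys2)" by simp
  then have "le (t x (foldr t xs u)) (t x (foldr t (ys1 @ ys2) u))"
    using Cons.IH by (simp add: shift_le foldr_in assms del: foldr_append)
  moreover have "le (t x (foldr t (ys1 @ ys2) u)) (foldr t ys u)"
    using foldr_commute1[of "foldr t ys2 u" ys1 x] by (simp add: ys foldr_in assms)
  ultimately show ?case
    using le_trans by (simp add: shift_in foldr_in assms del: foldr_append) (meson foldr_in shift_in assms)
qed

section \<open>Integer linear forms as differences of words\<close>

abbreviation ev :: "'x list \<Rightarrow> 'g" where
  "ev xs \<equiv> foldr t xs base"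

definition coeffs :: "'x list \<Rightarrow> 'x list \<Rightarrow> 'x \<Rightarrow> int" where
  "coeffs xs ys i = int (count (mset ys) i) - int (count (mset xs) i)"

definition pos :: "('x \<Rightarrow> int) \<Rightarrow> bool" where
  "pos f \<longleftrightarrow> (\<exists>xs ys. f = coeffs xs ys \<and> le (ev xs) (ev ys))"

lemma ev_in: "ev xs \<in> S"
  by (simp add: foldr_in base_in)

lemma ev_append: "le (ev (zs @ xs)) (ev (zs @ ys)) \<longleftrightarrow> le (ev xs) (ev ys)"
  by (simp add: foldr_le foldr_in base_in)

lemma ev_mset: "mset xs = mset ys \<Longrightarrow> le (ev xs) (ev ys)"
  by (simp add: foldr_mset_le base_in)

text \<open>The cancellation argument for groups of differences: if two pairs of words have the same
  form, then \<open>xs @ ys'\<close> and \<open>xs' @ ys\<close> are permutations of each other, and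
  the common prefix \<open>xs'\<close> cancels by \<open>ev_append\<close>.\<close>

lemma pos_coeffs: "pos (coeffs xs ys) \<longleftrightarrow> le (ev xs) (ev ys)"
proof
  assume "pos (coeffs xs ys)"
  then obtain xs' ys' where eq: "coeffs xs ys = coeffs xs' ys'" and le': "le (ev xs') (ev ys')"
    by (auto simp: pos_def)
  have m: "mset ys + mset xs' = mset ys' + mset xs"
  proof (rule multiset_eqI)
    show "count (mset ys + mset xs') i = count (mset ys' + mset xs) i" for i
      using fun_cong[OF eq, of i] by (simp add: coeffs_def)
  qed
  have "le (ev (xs' @ xs)) (ev (xs @ xs'))"
    by (rule ev_mset) simp
  moreover have "le (ev (xs @ xs')) (ev (xs @ ys'))"
    using le' by (simp only: ev_append)
  moreover have "le (ev (xs @ ys')) (ev (xs' @ ys))"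
    by (rule ev_mset) (use m in \<open>simp add: ac_simps\<close>)
  ultimately have "le (ev (xs' @ xs)) (ev (xs' @ ys))"
    by (meson le_trans ev_in)
  then show "le (ev xs) (ev ys)"
    by (simp only: ev_append)
qed (auto simp: pos_def)

lemma pos_add:
  assumes "pos f" "pos g"
  shows "pos (\<lambda>i. f i + g i)"
proof -
  from assms obtain xs ys xs' ys' where f: "f = coeffs xs ys" "le (ev xs) (ev ys)"
    and g: "g = coeffs xs' ys'" "le (ev xs') (ev ys')"
    by (auto simp: pos_def)
  have "le (ev (xs @ xs')) (ev (xs @ ys'))"
    using g by (simp only: ev_append)
  moreover have "le (ev (xs @ ys')) (ev (ys' @ xs))"
    by (rule ev_mset) simp
  moreover have "le (ev (ys' @ xs)) (ev (ys' @ ys))"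
    using f by (simp only: ev_append)
  ultimately have "le (ev (xs @ xs')) (ev (ys' @ ys))"
    by (meson le_trans ev_in)
  moreover have "(\<lambda>i. f i + g i) = coeffs (xs @ xs') (ys' @ ys)"
    by (auto simp: f g coeffs_def)
  ultimately show ?thesis by (simp add: pos_coeffs)
qed

lemma pos_total:
  assumes "finite X" and "\<And>i. i \<notin> X \<Longrightarrow> f i = 0"
  shows "pos f \<or> pos (\<lambda>i. - f i)"
proof -
  have ex: "\<exists>xs. \<forall>i. count (mset xs) i = (if i \<in> X then h i else 0)" for h :: "'x \<Rightarrow> nat"
  proof -
    obtain xs where "mset xs = (\<Sum>i\<in>X. replicate_mset (h i) i)"
      using ex_mset by blast
    then have "count (mset xs) i = (if i \<in> X then h i else 0)" for i
      using \<open>finite X\<close> by (simp add: count_sum)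
    then show ?thesis by blast
  qed
  obtain ys where ys: "\<And>i. count (mset ys) i = (if i \<in> X then nat (f i) else 0)"
    using ex[of "\<lambda>i. nat (f i)"] by blast
  obtain xs where xs: "\<And>i. count (mset xs) i = (if i \<in> X then nat (- f i) else 0)"
    using ex[of "\<lambda>i. nat (- f i)"] by blast
  have "f = coeffs xs ys" "(\<lambda>i. - f i) = coeffs ys xs"
    using assms(2) by (auto simp: coeffs_def xs ys)
  then show ?thesis
    using le_total[OF ev_in ev_in, of xs ys] by (simp add: pos_coeffs)
qed

text \<open>Even infinitesimal letters can be given real values here, because only the signs of the
  finitely many forms \<open>coeffs xs ys\<close> are reproduced. The letters occurring in
  \<open>D\<close> are the finite support for \<open>cone_realizable\<close>.\<close>

lemma realization:
  assumes "finite D"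
  shows "\<exists>v :: 'x \<Rightarrow> real. \<forall>(xs, ys)\<in>D. le (ev xs) (ev ys) \<longleftrightarrow> (\<Sum>x\<leftarrow>xs. v x) \<le> (\<Sum>x\<leftarrow>ys. v x)"
proof -
  define X where "X = (\<Union>(xs, ys)\<in>D. set xs \<union> set ys)"
  have finX: "finite X"
    using assms by (auto simp: X_def)
  have "\<exists>v :: 'x \<Rightarrow> real. \<forall>f\<in>(\<lambda>(xs, ys). coeffs xs ys) ` D.
      pos f \<longleftrightarrow> 0 \<le> (\<Sum>i\<in>X. of_int (f i) * v i)"
  proof (rule cone_realizable)
    show "f i = 0" if f: "f \<in> (\<lambda>(xs, ys). coeffs xs ys) ` D" and i: "i \<notin> X" for f i
    proof -
      obtain xs ys where "(xs, ys) \<in> D" "f = coeffs xs ys"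
        using f by auto
      moreover from this have "i \<notin> set xs \<union> set ys"
        using i by (auto simp: X_def)
      ultimately show ?thesis
        by (simp add: coeffs_def count_mset count_list_0_iff)
    qed
  qed (use assms finX pos_add pos_total in auto)
  then obtain v :: "'x \<Rightarrow> real" where
    v: "\<And>xs ys. (xs, ys) \<in> D \<Longrightarrow>
      pos (coeffs xs ys) \<longleftrightarrow> 0 \<le> (\<Sum>i\<in>X. of_int (coeffs xs ys i) * v i)"
    by fastforce
  have sum_eq: "(\<Sum>i\<in>X. real (count (mset xs) i) * v i) = (\<Sum>x\<leftarrow>xs. v x)" if "set xs \<subseteq> X" for xs
    using that
  proof (induction xs)
    case (Cons x xs)
    have "(\<Sum>i\<in>X. real (count (mset (x # xs)) i) * v i)
        = (\<Sum>i\<in>X. real (count (mset xs) i) * v i + (if i = x then v x else 0))"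
      by (rule sum.cong) (auto simp: algebra_simps)
    with Cons finX show ?case by (simp add: sum.distrib)
  qed simp
  have "le (ev xs) (ev ys) \<longleftrightarrow> (\<Sum>x\<leftarrow>xs. v x) \<le> (\<Sum>x\<leftarrow>ys. v x)" if "(xs, ys) \<in> D" for xs ys
  proof -
    have "set xs \<subseteq> X" "set ys \<subseteq> X"
      using that by (auto simp: X_def)
    then have "(\<Sum>i\<in>X. of_int (coeffs xs ys i) * v i) = (\<Sum>x\<leftarrow>ys. v x) - (\<Sum>x\<leftarrow>xs. v x)"
      by (simp add: coeffs_def left_diff_distrib sum_subtractf sum_eq)
    then show ?thesis
      using v[OF that] by (simp add: pos_coeffs)
  qed
  then show ?thesis by blast
qed

end

section \<open>Linearly ordered Wajsberg algebras\<close>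

text \<open>The elements are not identified up to equivalence: \<open>one \<rightharpoonup> x\<close> is the normal form of \<open>x\<close>, and
  equations between compound terms hold literally.\<close>

locale wajsberg =
  fixes imp :: "'a \<Rightarrow> 'a \<Rightarrow> 'a"  (infixr \<open>\<rightharpoonup>\<close> 60)
    and neg :: "'a \<Rightarrow> 'a" and one :: 'a
  assumes norm_one [simp]: "one \<rightharpoonup> one = one"
    and norm_imp [simp]: "one \<rightharpoonup> (x \<rightharpoonup> y) = x \<rightharpoonup> y"
    and norm_neg [simp]: "one \<rightharpoonup> neg x = neg x"
    and imp_norm_left [simp]: "(one \<rightharpoonup> x) \<rightharpoonup> y = x \<rightharpoonup> y"
    and imp_norm_right [simp]: "x \<rightharpoonup> (one \<rightharpoonup> y) = x \<rightharpoonup> y"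
    and neg_norm [simp]: "neg (one \<rightharpoonup> x) = neg x"
    and weaken [simp]: "x \<rightharpoonup> (y \<rightharpoonup> x) = one"
    and suffix: "(x \<rightharpoonup> y) \<rightharpoonup> ((y \<rightharpoonup> z) \<rightharpoonup> (x \<rightharpoonup> z)) = one"
    and vee_commute: "(x \<rightharpoonup> y) \<rightharpoonup> y = (y \<rightharpoonup> x) \<rightharpoonup> x"
    and neg_neg [simp]: "neg (neg x) = one \<rightharpoonup> x"
    and contrapose: "neg x \<rightharpoonup> neg y = y \<rightharpoonup> x"
begin

lemma imp_refl [simp]: "x \<rightharpoonup> x = one"
  using suffix[of one one x] by simp

lemma imp_one [simp]: "x \<rightharpoonup> one = one"
  using weaken[of x x] weaken[of one x] by simp

lemma imp_trans: "x \<rightharpoonup> y = one \<Longrightarrow> y \<rightharpoonup> z = one \<Longrightarrow> x \<rightharpoonup> z = one"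
  using suffix[of x y z] by simp

lemma imp_antisym: "x \<rightharpoonup> y = one \<Longrightarrow> y \<rightharpoonup> x = one \<Longrightarrow> one \<rightharpoonup> x = one \<rightharpoonup> y"
  using vee_commute[of x y] by simp

lemma imp_left_mono: "x \<rightharpoonup> y = one \<Longrightarrow> (y \<rightharpoonup> z) \<rightharpoonup> (x \<rightharpoonup> z) = one"
  using suffix[of x y z] by simp

lemma le_vee: "x \<rightharpoonup> ((x \<rightharpoonup> y) \<rightharpoonup> y) = one"
  by (simp add: vee_commute[of x y])

lemma exchange_le: "(x \<rightharpoonup> (y \<rightharpoonup> z)) \<rightharpoonup> (y \<rightharpoonup> (x \<rightharpoonup> z)) = one"
  using imp_trans[OF suffix[of x "y \<rightharpoonup> z" z] imp_left_mono[OF le_vee[of y z]]] .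

lemma exchange: "x \<rightharpoonup> (y \<rightharpoonup> z) = y \<rightharpoonup> (x \<rightharpoonup> z)"
  using imp_antisym[OF exchange_le[of x y z] exchange_le[of y x z]] by simp

lemma imp_right_mono: "y \<rightharpoonup> z = one \<Longrightarrow> (x \<rightharpoonup> y) \<rightharpoonup> (x \<rightharpoonup> z) = one"
  using suffix[of x y z] by (metis exchange norm_imp)

lemma contrapose_right: "x \<rightharpoonup> neg y = y \<rightharpoonup> neg x"
  using contrapose[of "neg x" y] by (simp add: contrapose)

lemma contrapose_left: "neg x \<rightharpoonup> y = neg y \<rightharpoonup> x"
  using contrapose[of x "neg y"] by simp

lemma ex_falso [simp]: "neg x \<rightharpoonup> (x \<rightharpoonup> y) = one" "x \<rightharpoonup> (neg x \<rightharpoonup> y) = one"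
  by (simp_all add: contrapose[of y x, symmetric] contrapose_left[of x y])

lemma vee_lub:
  assumes "x \<rightharpoonup> z = one" "y \<rightharpoonup> z = one"
  shows "((x \<rightharpoonup> y) \<rightharpoonup> y) \<rightharpoonup> z = one"
proof -
  have "((x \<rightharpoonup> y) \<rightharpoonup> y) \<rightharpoonup> ((z \<rightharpoonup> y) \<rightharpoonup> y) = one"
    by (intro imp_left_mono assms)
  then show ?thesis
    using assms by (simp add: vee_commute[of z y])
qed

lemma vee_imp: "((x \<rightharpoonup> y) \<rightharpoonup> y) \<rightharpoonup> y = x \<rightharpoonup> y"
  by (simp add: vee_commute[of "x \<rightharpoonup> y" y])

text \<open>With \<open>s = x \<or> y\<close> the two implications are \<open>s \<rightharpoonup> y\<close> and \<open>s \<rightharpoonup> x\<close>; contraposition turns the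
  implication between them into \<open>neg x \<rightharpoonup> neg y \<or> neg s\<close>, where \<open>neg s\<close> lies below \<open>neg y\<close>.\<close>

lemma prelinearity: "((x \<rightharpoonup> y) \<rightharpoonup> (y \<rightharpoonup> x)) \<rightharpoonup> (y \<rightharpoonup> x) = one"
proof -
  define s where "s = (x \<rightharpoonup> y) \<rightharpoonup> y"
  have sy: "s \<rightharpoonup> y = x \<rightharpoonup> y" "s \<rightharpoonup> x = y \<rightharpoonup> x"
    using vee_imp[of x y] vee_imp[of y x] by (simp_all add: s_def vee_commute)
  have "y \<rightharpoonup> s = one" by (simp add: s_def)
  have "(s \<rightharpoonup> y) \<rightharpoonup> (s \<rightharpoonup> x) = (neg y \<rightharpoonup> neg s) \<rightharpoonup> (neg x \<rightharpoonup> neg s)"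
    by (simp add: contrapose)
  also have "\<dots> = neg x \<rightharpoonup> ((neg s \<rightharpoonup> neg y) \<rightharpoonup> neg y)"
    by (simp add: exchange[of _ "neg x"] vee_commute)
  also have "\<dots> = y \<rightharpoonup> x"
    using \<open>y \<rightharpoonup> s = one\<close> by (simp add: contrapose)
  finally show ?thesis by (simp add: sy)
qed

text \<open>Modus ponens under a fixed disjunct \<open>z\<close>, which later makes residual sets
  closed under modus ponens. Both joins are eliminated by \<open>vee_lub\<close>, with an exchange
  of premises in between.\<close>

lemma vee_mp:
  "((x \<rightharpoonup> z) \<rightharpoonup> z) \<rightharpoonup> (((((x \<rightharpoonup> y) \<rightharpoonup> z) \<rightharpoonup> z)) \<rightharpoonup> ((y \<rightharpoonup> z) \<rightharpoonup> z)) = one"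
proof (rule vee_lub)
  let ?C = "(y \<rightharpoonup> z) \<rightharpoonup> z"
  have "z \<rightharpoonup> ?C = one" by simp
  have "(((x \<rightharpoonup> y) \<rightharpoonup> z) \<rightharpoonup> z) \<rightharpoonup> (x \<rightharpoonup> ?C) = one"
  proof (rule vee_lub)
    show "(x \<rightharpoonup> y) \<rightharpoonup> (x \<rightharpoonup> ?C) = one"
      by (intro imp_right_mono le_vee)
    show "z \<rightharpoonup> (x \<rightharpoonup> ?C) = one"
      using imp_trans[OF \<open>z \<rightharpoonup> ?C = one\<close> weaken] .
  qed
  then show "x \<rightharpoonup> ((((x \<rightharpoonup> y) \<rightharpoonup> z) \<rightharpoonup> z) \<rightharpoonup> ?C) = one"
    by (simp only: exchange[of x])
  show "z \<rightharpoonup> ((((x \<rightharpoonup> y) \<rightharpoonup> z) \<rightharpoonup> z) \<rightharpoonup> ?C) = one"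
    using imp_trans[OF \<open>z \<rightharpoonup> ?C = one\<close> weaken] .
qed

text \<open>The negated form of divisibility, \<open>v \<odot> (v \<rightharpoonup> x) = x\<close>
  for \<open>x\<close> below \<open>v\<close>; it is \<open>vee_commute\<close> read through
  contraposition.\<close>

lemma neg_meet:
  assumes "x \<rightharpoonup> v = one"
  shows "v \<rightharpoonup> neg (v \<rightharpoonup> x) = neg x"
proof -
  have "v \<rightharpoonup> neg (v \<rightharpoonup> x) = (neg x \<rightharpoonup> neg v) \<rightharpoonup> neg v"
    by (simp add: contrapose_right[of v] contrapose)
  also have "\<dots> = (neg v \<rightharpoonup> neg x) \<rightharpoonup> neg x"
    by (rule vee_commute)
  also have "\<dots> = (x \<rightharpoonup> v) \<rightharpoonup> neg x"
    by (simp add: contrapose)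
  finally show ?thesis using assms by simp
qed

text \<open>In \<open>[0,1]\<close> both sides are \<open>min 1 (1 + v - x - y)\<close>. Writing
  \<open>neg y\<close> as \<open>v \<rightharpoonup> neg (v \<rightharpoonup> y)\<close> exposes the
  symmetry. For \<open>v = neg a\<close> it says
  \<open>(a \<oplus> x) \<odot> y = (a \<oplus> y) \<odot> x\<close>.\<close>

lemma odot_oplus_swap:
  assumes "x \<rightharpoonup> v = one" "y \<rightharpoonup> v = one"
  shows "(v \<rightharpoonup> x) \<rightharpoonup> neg y = (v \<rightharpoonup> y) \<rightharpoonup> neg x"
proof -
  have "(v \<rightharpoonup> x) \<rightharpoonup> neg y = v \<rightharpoonup> ((v \<rightharpoonup> x) \<rightharpoonup> neg (v \<rightharpoonup> y))"
    by (simp add: neg_meet[OF assms(2), symmetric] exchange[of "v \<rightharpoonup> x" v])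
  also have "\<dots> = (v \<rightharpoonup> y) \<rightharpoonup> (v \<rightharpoonup> neg (v \<rightharpoonup> x))"
    by (simp add: contrapose_right[of "v \<rightharpoonup> x"] exchange[of "v \<rightharpoonup> y"])
  also have "\<dots> = (v \<rightharpoonup> y) \<rightharpoonup> neg x"
    by (simp only: neg_meet[OF assms(1)])
  finally show ?thesis .
qed

text \<open>In \<open>[0,1]\<close> both sides are \<open>x + y - v\<close>. It serves the situation
  where adding \<open>x\<close> to \<open>neg v\<close> carries and adding \<open>y\<close> does
  not.\<close>

lemma odot_oplus_mixed:
  assumes "y \<rightharpoonup> v = one" "v \<rightharpoonup> x = one"
  shows "(x \<rightharpoonup> v) \<rightharpoonup> y = neg ((v \<rightharpoonup> y) \<rightharpoonup> neg x)"
proof -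
  define q p r where "q = x \<rightharpoonup> v" and "p = v \<rightharpoonup> y" and "r = p \<rightharpoonup> neg x"
  have "neg p \<rightharpoonup> v = one"
    by (simp add: p_def contrapose_left[of _ v])
  then have "r \<rightharpoonup> q = one"
    by (simp add: r_def q_def contrapose_right[of p] imp_right_mono)
  have "q \<rightharpoonup> y = (v \<rightharpoonup> neg p) \<rightharpoonup> neg q"
    by (simp add: p_def neg_meet[OF assms(1)] contrapose)
  also have "v \<rightharpoonup> neg p = p \<rightharpoonup> (x \<rightharpoonup> neg q)"
    by (simp add: q_def neg_meet[OF assms(2)] contrapose_right[of v])
  also have "\<dots> = neg r \<rightharpoonup> neg q"
    by (simp add: r_def contrapose contrapose_right[of x] exchange[of p])
  also have "(neg r \<rightharpoonup> neg q) \<rightharpoonup> neg q = (neg q \<rightharpoonup> neg r) \<rightharpoonup> neg r"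
    by (rule vee_commute)
  also have "\<dots> = neg r"
    using \<open>r \<rightharpoonup> q = one\<close> by (simp add: contrapose)
  finally show ?thesis by (simp add: q_def p_def r_def)
qed

end

text \<open>Chang's construction: the chain is the unit interval of an ordered group, whose elements are
  pairs of an integer part and a remainder. \<open>shift x\<close> is addition of \<open>x\<close> with carry.\<close>

locale wajsberg_chain = wajsberg +
  assumes linear: "x \<rightharpoonup> y = one \<or> y \<rightharpoonup> x = one"
    and nontrivial: "neg one \<noteq> one"
begin

text \<open>The remainder \<open>one\<close> is excluded because \<open>(k, one)\<close> and
  \<open>(k + 1, neg one)\<close> would be the same group element; requiring normal forms makes
  \<open>lex_le\<close> antisymmetric.\<close>

definition unwrapped :: "(int \<times> 'a) set" where
  "unwrapped = {(k, a). a \<noteq> one \<and> one \<rightharpoonup> a = a}"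

definition lex_le :: "int \<times> 'a \<Rightarrow> int \<times> 'a \<Rightarrow> bool" where
  "lex_le = (\<lambda>(k, a) (m, b). k < m \<or> k = m \<and> a \<rightharpoonup> b = one)"

definition shift :: "'a \<Rightarrow> int \<times> 'a \<Rightarrow> int \<times> 'a" where
  "shift x = (\<lambda>(k, a). if neg a \<rightharpoonup> x = one then (k + 1, neg (a \<rightharpoonup> neg x)) else (k, neg a \<rightharpoonup> x))"

text \<open>The term is \<open>a \<odot> x\<close>, the remainder \<open>a + x - 1\<close> after a
  carry. It lies below \<open>a\<close>, so a carry never leaves the remainder
  \<open>one\<close>.\<close>

lemma odot_ne_one:
  assumes "one \<rightharpoonup> a \<noteq> one"
  shows "neg (a \<rightharpoonup> neg x) \<noteq> one"
proof
  assume "neg (a \<rightharpoonup> neg x) = one"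
  moreover have "neg (a \<rightharpoonup> neg x) \<rightharpoonup> a = one"
    by (simp add: contrapose_left[of _ a] contrapose_right[of a])
  ultimately show False using assms by simp
qed

lemma shift_in: "u \<in> unwrapped \<Longrightarrow> shift x u \<in> unwrapped"
  using odot_ne_one[of "snd u" x] by (cases u) (auto simp: unwrapped_def shift_def)

text \<open>In the group this is \<open>x + (1 - x) = 1\<close>: exactly one of the two additions
  carries. It makes every shift injective and later determines the value of a negation.\<close>

lemma shift_neg_shift:
  assumes "(k, a) \<in> unwrapped"
  shows "shift (neg x) (shift x (k, a)) = (k + 1, a)"
proof (cases "neg a \<rightharpoonup> x = one")
  case True
  then have "neg x \<rightharpoonup> a = one"
    by (simp add: contrapose_left[of x])
  have "neg (neg (a \<rightharpoonup> neg x)) \<rightharpoonup> neg x = one \<rightharpoonup> a"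
    using \<open>neg x \<rightharpoonup> a = one\<close> by (simp add: vee_commute[of a])
  then show ?thesis
    using True assms by (simp add: shift_def unwrapped_def)
next
  case False
  then have "x \<rightharpoonup> neg a = one"
    using linear by blast
  have "neg (neg a \<rightharpoonup> x) \<rightharpoonup> neg x = one"
    by (simp add: contrapose)
  moreover have "neg ((neg a \<rightharpoonup> x) \<rightharpoonup> neg (neg x)) = one \<rightharpoonup> a"
    using \<open>x \<rightharpoonup> neg a = one\<close> by (simp add: vee_commute[of "neg a"])
  ultimately show ?thesis
    using False assms by (simp add: shift_def unwrapped_def)
qed

lemma shift_mono:
  assumes "u \<in> unwrapped" "w \<in> unwrapped" "lex_le u w"
  shows "lex_le (shift x u) (shift x w)"
proof -
  obtain k a m b where uw: "u = (k, a)" "w = (m, b)" by fastforce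
  consider "k < m" | "k = m" "a \<rightharpoonup> b = one"
    using assms uw by (auto simp: lex_le_def)
  then show ?thesis
  proof cases
    case 1
    \<comment> \<open>The critical case is \<open>m = k + 1\<close> with a carry for
      \<open>a\<close> only: the integer parts then agree, and
      \<open>a \<odot> x \<le> x \<le> a' \<oplus> x\<close> with \<open>a' = b\<close> compares the
      remainders.\<close>
    have "neg (a \<rightharpoonup> neg x) \<rightharpoonup> (neg b \<rightharpoonup> x) = one"
    proof (rule imp_trans)
      show "neg (a \<rightharpoonup> neg x) \<rightharpoonup> x = one" by (simp add: contrapose_left[of _ x])
    qed simp
    with 1 show ?thesis by (auto simp: uw lex_le_def shift_def)
  next
    case 2
    have *: "(neg a \<rightharpoonup> x) \<rightharpoonup> (neg b \<rightharpoonup> x) = one"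
      using 2 by (intro imp_left_mono) (simp add: contrapose)
    moreover have "neg (a \<rightharpoonup> neg x) \<rightharpoonup> neg (b \<rightharpoonup> neg x) = one"
      using 2 by (simp add: contrapose imp_left_mono)
    moreover have "neg b \<rightharpoonup> x = one" if "neg a \<rightharpoonup> x = one"
      using * that by simp
    ultimately show ?thesis
      using 2 by (auto simp: uw lex_le_def shift_def)
  qed
qed

text \<open>The cases are which of \<open>x\<close> and \<open>y\<close> carries when added to
  \<open>a\<close> alone. If both do, \<open>odot_oplus_swap\<close> applies with
  \<open>v = a\<close>; if neither does, with \<open>v = neg a\<close>; if exactly one does,
  \<open>odot_oplus_mixed\<close> applies.\<close>

lemma shift_commute:
  assumes "u \<in> unwrapped"
  shows "shift x (shift y u) = shift y (shift x u)"
proof -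
  obtain k a where u: "u = (k, a)" by fastforce
  have a: "one \<rightharpoonup> a \<noteq> one"
    using assms by (simp add: u unwrapped_def)
  have mixed: "shift y (shift x (k, a)) = shift x (shift y (k, a))"
    if "neg a \<rightharpoonup> x = one" "neg a \<rightharpoonup> y \<noteq> one" for x y
  proof -
    have "y \<rightharpoonup> neg a = one"
      using linear that by blast
    from odot_oplus_mixed[OF this that(1)]
    have eq: "(a \<rightharpoonup> neg x) \<rightharpoonup> y = neg ((neg a \<rightharpoonup> y) \<rightharpoonup> neg x)"
      by (simp add: contrapose_right[of x])
    then have "(a \<rightharpoonup> neg x) \<rightharpoonup> y \<noteq> one"
      using odot_ne_one[of "neg a \<rightharpoonup> y" x] that by simp
    moreover have "neg (neg a \<rightharpoonup> y) \<rightharpoonup> x = one"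
    proof -
      have "neg (neg a \<rightharpoonup> y) \<rightharpoonup> neg a = one"
        by (simp add: contrapose)
      then show ?thesis using that(1) by (rule imp_trans)
    qed
    ultimately show ?thesis
      using that eq by (simp add: shift_def)
  qed
  consider "neg a \<rightharpoonup> x = one" "neg a \<rightharpoonup> y \<noteq> one" | "neg a \<rightharpoonup> y = one" "neg a \<rightharpoonup> x \<noteq> one"
    | "neg a \<rightharpoonup> x = one" "neg a \<rightharpoonup> y = one" | "neg a \<rightharpoonup> x \<noteq> one" "neg a \<rightharpoonup> y \<noteq> one"
    by blast
  then show ?thesis
  proof cases
    case 3
    then have "neg x \<rightharpoonup> a = one" "neg y \<rightharpoonup> a = one"
      by (simp_all add: contrapose_left[of _ a])
    from odot_oplus_swap[OF this]
    have "(a \<rightharpoonup> neg x) \<rightharpoonup> y = (a \<rightharpoonup> neg y) \<rightharpoonup> x" by simp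
    moreover have "neg (a \<rightharpoonup> neg x) \<rightharpoonup> neg y = neg (a \<rightharpoonup> neg y) \<rightharpoonup> neg x"
      by (simp add: contrapose exchange[of y] exchange[of x] contrapose_right[of y])
    ultimately show ?thesis
      using 3 by (simp add: u shift_def)
  next
    case 4
    then have "x \<rightharpoonup> neg a = one" "y \<rightharpoonup> neg a = one"
      using linear by blast+
    from odot_oplus_swap[OF this]
    have "(neg a \<rightharpoonup> x) \<rightharpoonup> neg y = (neg a \<rightharpoonup> y) \<rightharpoonup> neg x" .
    moreover have "neg (neg a \<rightharpoonup> x) \<rightharpoonup> y = neg (neg a \<rightharpoonup> y) \<rightharpoonup> x"
      using contrapose_left exchange by metis
    ultimately show ?thesis
      using 4 by (simp add: u shift_def)
  qed (use mixed[of x y] mixed[of y x] in \<open>simp_all add: u\<close>)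
qed

lemma lex_le_antisym:
  assumes "u \<in> unwrapped" "w \<in> unwrapped" "lex_le u w" "lex_le w u"
  shows "u = w"
  using assms imp_antisym[of "snd u" "snd w"]
  by (cases u, cases w) (auto simp: unwrapped_def lex_le_def)

lemma lex_le_total: "lex_le u w \<or> lex_le w u"
  using linear by (auto simp: lex_le_def)

lemma lex_le_refl: "lex_le u u"
  by (cases u) (simp add: lex_le_def)

lemma shift_inj:
  assumes "u \<in> unwrapped" "w \<in> unwrapped" "shift x u = shift x w"
  shows "u = w"
proof -
  obtain k a m b where uw: "u = (k, a)" "w = (m, b)" by fastforce
  have "(k + 1, a) = (m + 1, b)"
    using assms(3) shift_neg_shift[OF assms(1)[unfolded uw]] shift_neg_shift[OF assms(2)[unfolded uw]]
    unfolding uw by metis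
  then show ?thesis by (simp add: uw)
qed

text \<open>The base point \<open>(0, neg one)\<close> is the zero of the group, so a word evaluates
  to the sum of its letters.\<close>

sublocale commuting_shifts lex_le unwrapped shift "(0, neg one)"
proof
  fix u w :: "int \<times> 'a"
  assume uw: "u \<in> unwrapped" "w \<in> unwrapped"
  show "lex_le u w \<or> lex_le w u" by (rule lex_le_total)
  show "lex_le (shift x u) (shift x w) \<longleftrightarrow> lex_le u w" for x
  proof
    assume le: "lex_le (shift x u) (shift x w)"
    show "lex_le u w"
    proof (rule ccontr)
      assume "\<not> lex_le u w"
      then have "lex_le w u" using lex_le_total by blast
      then have "shift x u = shift x w"
        using uw by (intro lex_le_antisym shift_in le shift_mono)
      then have "u = w"
        by (rule shift_inj[OF uw])
      with \<open>\<not> lex_le u w\<close> show False using lex_le_refl by simp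
    qed
  qed (rule shift_mono[OF uw])
next
  show "lex_le u y" if "lex_le u w" "lex_le w y" for u w y
    using that imp_trans[of "snd u" "snd w" "snd y"]
    by (cases u, cases w, cases y) (auto simp: lex_le_def)
next
  show "shift x u \<in> unwrapped" if "u \<in> unwrapped" for x u
    using that by (rule shift_in)
next
  show "lex_le (shift x (shift x' u)) (shift x' (shift x u))" if "u \<in> unwrapped" for x x' u
    by (simp only: shift_commute[OF that, of x x'] lex_le_refl)
next
  show "(0, neg one) \<in> unwrapped"
    by (simp add: unwrapped_def nontrivial)
qed

end

section \<open>Real valuations of finite parts of a chain\<close>

context wajsberg_chain
begin

lemma imp_top: "one \<rightharpoonup> y = one \<Longrightarrow> x \<rightharpoonup> y = one"
  by (metis imp_norm_right imp_one)

lemma top_imp: "one \<rightharpoonup> x = one \<Longrightarrow> x \<rightharpoonup> y = one \<rightharpoonup> y"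
  by (metis imp_norm_left)

lemma shift_base: "shift x (k, neg one) = (if one \<rightharpoonup> x = one then (k + 1, neg one) else (k, one \<rightharpoonup> x))"
  by (simp add: shift_def contrapose)

lemma shift_one: "shift one (k, a) = (k + 1, one \<rightharpoonup> a)"
  by (simp add: shift_def contrapose_right[of a])

text \<open>This is \<open>(1 - x + y) + x = 1 + y\<close> in the group; the hypothesis says that
  the implication is not truncated.\<close>

lemma shift_imp:
  assumes "x \<rightharpoonup> y \<noteq> one"
  shows "shift (x \<rightharpoonup> y) (shift x (0, neg one)) = shift one (shift y (0, neg one))"
proof -
  have "y \<rightharpoonup> x = one"
    using linear assms by blast
  have "one \<rightharpoonup> y \<noteq> one"
    using assms imp_top by blast
  then have rhs: "shift one (shift y (0, neg one)) = (1, one \<rightharpoonup> y)"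
    by (simp add: shift_base shift_one)
  show ?thesis
  proof (cases "one \<rightharpoonup> x = one")
    case True
    then have "x \<rightharpoonup> y = one \<rightharpoonup> y"
      by (rule top_imp)
    with True \<open>one \<rightharpoonup> y \<noteq> one\<close> show ?thesis
      unfolding rhs by (simp add: shift_base)
  next
    case False
    then show ?thesis
      unfolding rhs by (simp add: shift_base) (simp add: shift_def neg_meet[OF \<open>y \<rightharpoonup> x = one\<close>])
  qed
qed

lemma finite_valuation:
  assumes "finite F"
  obtains e :: "'a \<Rightarrow> real"
  where "\<And>x. x \<in> F \<Longrightarrow> 0 \<le> e x \<and> e x \<le> 1"
    and "\<And>x. x \<in> F \<Longrightarrow> e x = 1 \<longleftrightarrow> one \<rightharpoonup> x = one"
    and "\<And>x. x \<in> F \<Longrightarrow> e (neg x) = 1 - e x"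
    and "\<And>x y. x \<in> F \<Longrightarrow> y \<in> F \<Longrightarrow> e (x \<rightharpoonup> y) = min 1 (1 - e x + e y)"
proof -
  define F' where "F' = insert one F \<union> neg ` F \<union> (\<lambda>(x, y). x \<rightharpoonup> y) ` (F \<times> F)"
  \<comment> \<open>Length two suffices: the group equations behind the clauses are
    \<open>neg x + x = 1\<close> and \<open>(x \<rightharpoonup> y) + x = 1 + y\<close>, and the
    remaining conditions compare single letters or the empty word.\<close>
  define L where "L = {xs. set xs \<subseteq> F' \<and> length xs \<le> 2}"
  have "finite F'" using assms by (simp add: F'_def)
  then have "finite (L \<times> L)"
    unfolding L_def by (intro finite_cartesian_product finite_lists_length_le)
  from realization[OF this] obtain v :: "'a \<Rightarrow> real" where
    v: "\<And>xs ys. xs \<in> L \<Longrightarrow> ys \<in> L \<Longrightarrow> lex_le (ev xs) (ev ys) \<longleftrightarrow> (\<Sum>x\<leftarrow>xs. v x) \<le> (\<Sum>x\<leftarrow>ys. v x)"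
    by blast
  have v_eq: "(\<Sum>x\<leftarrow>xs. v x) = (\<Sum>x\<leftarrow>ys. v x)" if "ev xs = ev ys" "xs \<in> L" "ys \<in> L" for xs ys
    using v[OF that(2,3)] v[OF that(3,2)] le_refl[OF ev_in] that(1) by (metis order_antisym)
  have inL: "[] \<in> L" "[one] \<in> L"
    by (simp_all add: L_def F'_def)
  have inL': "[x] \<in> L" "[neg x, x] \<in> L" "[x \<rightharpoonup> y] \<in> L" "[x \<rightharpoonup> y, x] \<in> L" "[one, y] \<in> L"
    if "x \<in> F" "y \<in> F" for x y
    using that by (auto simp: L_def F'_def)
  have ev1: "ev [one] = (1, neg one)"
    by (simp add: shift_base)
  have base_not: "\<not> lex_le (ev [one]) (ev [])"
    unfolding ev1 by (simp add: lex_le_def)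
  then have pos: "0 < v one"
    using v[OF inL(2,1)] by simp
  have ev_x: "ev [x] = (if one \<rightharpoonup> x = one then (1, neg one) else (0, one \<rightharpoonup> x))" for x
    by (simp add: shift_base)
  have bot_le: "neg one \<rightharpoonup> x = one" for x
    using ex_falso(1)[of one x] by simp
  have nonneg: "0 \<le> v x" if "x \<in> F" for x
    using v[OF inL(1) inL'(1)[OF that that]] unfolding ev_x by (auto simp: lex_le_def bot_le split: if_splits)
  have le_one: "v x \<le> v one" and eq_one: "v x = v one \<longleftrightarrow> one \<rightharpoonup> x = one" if "x \<in> F" for x
  proof -
    have "lex_le (ev [x]) (ev [one])" "lex_le (ev [one]) (ev [x]) \<longleftrightarrow> one \<rightharpoonup> x = one"
      unfolding ev_x ev1 by (auto simp: lex_le_def)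
    then show "v x \<le> v one" "v x = v one \<longleftrightarrow> one \<rightharpoonup> x = one"
      using v[OF inL(2) inL'(1)[OF that that]] v[OF inL'(1)[OF that that] inL(2)] by auto
  qed
  have neg_sum: "v (neg x) + v x = v one" if "x \<in> F" for x
  proof -
    have "ev [neg x, x] = ev [one]"
      unfolding ev1 using shift_neg_shift[OF base_in, of x] by simp
    from v_eq[OF this inL'(2)[OF that that] inL(2)] show ?thesis by simp
  qed
  have imp_sum: "v (x \<rightharpoonup> y) = min (v one) (v one - v x + v y)" if "x \<in> F" "y \<in> F" for x y
  proof (cases "x \<rightharpoonup> y = one")
    case True
    have "lex_le (ev [x]) (ev [y])"
    proof (cases "one \<rightharpoonup> x = one")
      case True
      then have "one \<rightharpoonup> y = one"
        using \<open>x \<rightharpoonup> y = one\<close> top_imp by metis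
      with True show ?thesis unfolding ev_x by (simp add: lex_le_def)
    next
      case False
      with \<open>x \<rightharpoonup> y = one\<close> show ?thesis unfolding ev_x by (simp add: lex_le_def)
    qed
    then have "v x \<le> v y"
      using v[OF inL'(1,1)] that by simp
    then show ?thesis using True by simp
  next
    case False
    have "ev [x \<rightharpoonup> y, x] = ev [one, y]"
      using shift_imp[OF False] by simp
    from v_eq[OF this inL'(4,5)] that have "v (x \<rightharpoonup> y) + v x = v one + v y" by simp
    moreover have "lex_le (ev [y]) (ev [x])"
    proof -
      have "y \<rightharpoonup> x = one" using linear False by blast
      moreover have "one \<rightharpoonup> y \<noteq> one"
        using False imp_top by blast
      ultimately show ?thesis unfolding ev_x by (simp add: lex_le_def)
    qed
    then have "v y \<le> v x"
      using v[OF inL'(1,1)] that by simp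
    ultimately show ?thesis by simp
  qed
  \<comment> \<open>The real value \<open>v one\<close> of the unit is positive but otherwise
    arbitrary, so the valuation is \<open>v x / v one\<close>.\<close>
  show thesis
  proof
    fix x y assume "x \<in> F" "y \<in> F"
    have "v (x \<rightharpoonup> y) / v one = min (v one / v one) ((v one - v x + v y) / v one)"
      using pos by (simp only: imp_sum[OF \<open>x \<in> F\<close> \<open>y \<in> F\<close>] min_divide_distrib_right) simp
    then show "v (x \<rightharpoonup> y) / v one = min 1 (1 - v x / v one + v y / v one)"
      using pos by (simp add: add_divide_distrib diff_divide_distrib)
  next
    fix x assume "x \<in> F"
    then show "0 \<le> v x / v one \<and> v x / v one \<le> 1" "v x / v one = 1 \<longleftrightarrow> one \<rightharpoonup> x = one"
      "v (neg x) / v one = 1 - v x / v one"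
      using pos nonneg le_one eq_one[of x, symmetric] neg_sum[of x] by (auto simp: field_simps)
  qed
qed

end

section \<open>Completeness of Lukasiewicz logic for finite sets of premises\<close>

text \<open>Arbitrary closed sets are allowed, not only sets of consequences of given axioms, so
  that unions of chains and residual sets are instances.\<close>

locale luk_theory =
  fixes T :: "'c fm set"
  assumes ax: "luk_ax \<phi> \<Longrightarrow> \<phi> \<in> T"
    and mp: "\<phi> \<^bold>\<rightarrow> \<psi> \<in> T \<Longrightarrow> \<phi> \<in> T \<Longrightarrow> \<psi> \<in> T"
begin

lemmas L1 = luk_ax.L1[THEN ax] and L2 = luk_ax.L2[THEN ax]
  and L3 = luk_ax.L3[THEN ax, unfolded Disj_def] and L4 = luk_ax.L4[THEN ax]

lemma trans: "\<phi> \<^bold>\<rightarrow> \<psi> \<in> T \<Longrightarrow> \<psi> \<^bold>\<rightarrow> \<chi> \<in> T \<Longrightarrow> \<phi> \<^bold>\<rightarrow> \<chi> \<in> T"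
  using L2 mp by blast

lemma imp_mem: "\<psi> \<in> T \<Longrightarrow> \<phi> \<^bold>\<rightarrow> \<psi> \<in> T"
  using L1 mp by blast

lemma mem_imp_imp: "\<phi> \<in> T \<Longrightarrow> (\<phi> \<^bold>\<rightarrow> \<psi>) \<^bold>\<rightarrow> \<psi> \<in> T"
  using L3 mp imp_mem by blast

lemma refl: "\<phi> \<^bold>\<rightarrow> \<phi> \<in> T"
proof -
  have "(\<phi> \<^bold>\<rightarrow> (\<phi> \<^bold>\<rightarrow> \<phi>)) \<^bold>\<rightarrow> \<phi> \<^bold>\<rightarrow> \<phi> \<in> T"
    using trans[OF L1 mem_imp_imp[OF L1]] imp_mem mp by blast
  then show ?thesis using L1 mp by blast
qed

lemma exchange: "(\<phi> \<^bold>\<rightarrow> \<psi> \<^bold>\<rightarrow> \<chi>) \<^bold>\<rightarrow> \<psi> \<^bold>\<rightarrow> \<phi> \<^bold>\<rightarrow> \<chi> \<in> T"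
proof -
  have "\<psi> \<^bold>\<rightarrow> (\<psi> \<^bold>\<rightarrow> \<chi>) \<^bold>\<rightarrow> \<chi> \<in> T"
    using trans[OF L1 L3] .
  then show ?thesis
    using trans[OF L2 mp[OF L2]] by blast
qed

lemma imp_right_mono: "\<phi> \<^bold>\<rightarrow> \<psi> \<in> T \<Longrightarrow> (\<chi> \<^bold>\<rightarrow> \<phi>) \<^bold>\<rightarrow> \<chi> \<^bold>\<rightarrow> \<psi> \<in> T"
  using mp[OF mp[OF exchange L2]] .

lemma imp_left_mono: "\<phi> \<^bold>\<rightarrow> \<psi> \<in> T \<Longrightarrow> (\<psi> \<^bold>\<rightarrow> \<chi>) \<^bold>\<rightarrow> \<phi> \<^bold>\<rightarrow> \<chi> \<in> T"
  using mp[OF L2] .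

definition verum :: "'c fm" where
  "verum = Var 0 \<^bold>\<rightarrow> Var 0"

lemma verum: "verum \<in> T"
  unfolding verum_def by (rule refl)

lemma neg_neg_elim: "\<^bold>\<not> \<^bold>\<not> \<phi> \<^bold>\<rightarrow> \<phi> \<in> T"
proof -
  have "\<^bold>\<not> \<^bold>\<not> \<phi> \<^bold>\<rightarrow> verum \<^bold>\<rightarrow> \<phi> \<in> T"
    using trans[OF trans[OF L1 L4] L4] .
  then show ?thesis
    using mp exchange verum by blast
qed

lemma neg_neg_intro: "\<phi> \<^bold>\<rightarrow> \<^bold>\<not> \<^bold>\<not> \<phi> \<in> T"
  using mp[OF L4 neg_neg_elim] .

lemma contrapose: "(\<phi> \<^bold>\<rightarrow> \<psi>) \<^bold>\<rightarrow> \<^bold>\<not> \<psi> \<^bold>\<rightarrow> \<^bold>\<not> \<phi> \<in> T"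
  using trans[OF trans[OF imp_left_mono[OF neg_neg_elim] imp_right_mono[OF neg_neg_intro]] L4] .

definition eqv :: "'c fm \<Rightarrow> 'c fm \<Rightarrow> bool" where
  "eqv \<phi> \<psi> \<longleftrightarrow> \<phi> \<^bold>\<rightarrow> \<psi> \<in> T \<and> \<psi> \<^bold>\<rightarrow> \<phi> \<in> T"

text \<open>Chosen representatives replace equivalence classes, so the Lindenbaum algebra of
  \<open>T\<close> has formulas as its elements. The normal forms of \<open>wajsberg\<close> are
  these representatives, by \<open>rep_verum_imp\<close>.\<close>

definition rep :: "'c fm \<Rightarrow> 'c fm" where
  "rep \<phi> = (SOME \<psi>. eqv \<phi> \<psi>)"

lemma eqv_rep: "eqv \<phi> (rep \<phi>)"
  unfolding rep_def by (rule someI[of _ \<phi>]) (simp add: eqv_def refl)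

lemma eqv_sym: "eqv \<phi> \<psi> \<Longrightarrow> eqv \<psi> \<phi>"
  by (simp add: eqv_def)

lemma eqv_trans: "eqv \<phi> \<psi> \<Longrightarrow> eqv \<psi> \<chi> \<Longrightarrow> eqv \<phi> \<chi>"
  using trans unfolding eqv_def by blast

lemma rep_eq_iff: "rep \<phi> = rep \<psi> \<longleftrightarrow> eqv \<phi> \<psi>"
proof
  assume "rep \<phi> = rep \<psi>"
  then show "eqv \<phi> \<psi>"
    using eqv_trans eqv_sym eqv_rep by metis
next
  assume "eqv \<phi> \<psi>"
  then have "eqv \<phi> = eqv \<psi>"
    using eqv_trans eqv_sym by blast
  then show "rep \<phi> = rep \<psi>" by (simp add: rep_def)
qed

lemma rep_imp_cong: "eqv \<phi> \<phi>' \<Longrightarrow> eqv \<psi> \<psi>' \<Longrightarrow> rep (\<phi> \<^bold>\<rightarrow> \<psi>) = rep (\<phi>' \<^bold>\<rightarrow> \<psi>')"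
  using trans[OF imp_left_mono imp_right_mono] unfolding rep_eq_iff eqv_def by blast

lemma rep_imp_rep [simp]: "rep (rep \<phi> \<^bold>\<rightarrow> \<psi>) = rep (\<phi> \<^bold>\<rightarrow> \<psi>)" "rep (\<phi> \<^bold>\<rightarrow> rep \<psi>) = rep (\<phi> \<^bold>\<rightarrow> \<psi>)"
  by (auto intro!: rep_imp_cong eqv_sym[OF eqv_rep] simp: eqv_def refl)

lemma rep_neg_rep [simp]: "rep (\<^bold>\<not> rep \<phi>) = rep (\<^bold>\<not> \<phi>)"
  using eqv_rep[of \<phi>] mp[OF contrapose] unfolding rep_eq_iff eqv_def by blast

lemma rep_verum_iff: "rep \<phi> = rep verum \<longleftrightarrow> \<phi> \<in> T"
  unfolding rep_eq_iff eqv_def using mp verum imp_mem by blast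

lemma rep_verum_imp [simp]: "rep (verum \<^bold>\<rightarrow> \<phi>) = rep \<phi>"
  unfolding rep_eq_iff eqv_def using L1 mem_imp_imp verum by blast

lemma rep_rep [simp]: "rep (rep \<phi>) = rep \<phi>"
  unfolding rep_eq_iff using eqv_rep eqv_sym by blast

sublocale alg: wajsberg "\<lambda>\<phi> \<psi>. rep (\<phi> \<^bold>\<rightarrow> \<psi>)" "\<lambda>\<phi>. rep (\<^bold>\<not> \<phi>)" "rep verum"
proof
  fix x y z
  show "rep (x \<^bold>\<rightarrow> rep (y \<^bold>\<rightarrow> x)) = rep verum"
    by (simp add: rep_verum_iff L1)
  show "rep (rep (x \<^bold>\<rightarrow> y) \<^bold>\<rightarrow> rep (rep (y \<^bold>\<rightarrow> z) \<^bold>\<rightarrow> rep (x \<^bold>\<rightarrow> z))) = rep verum"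
    by (simp add: rep_verum_iff L2)
  show "rep (rep (x \<^bold>\<rightarrow> y) \<^bold>\<rightarrow> y) = rep (rep (y \<^bold>\<rightarrow> x) \<^bold>\<rightarrow> x)"
    by (simp add: rep_eq_iff eqv_def L3)
  show "rep (\<^bold>\<not> rep (\<^bold>\<not> x)) = rep (rep verum \<^bold>\<rightarrow> x)"
    by (simp add: rep_eq_iff eqv_def neg_neg_elim neg_neg_intro)
  show "rep (rep (\<^bold>\<not> x) \<^bold>\<rightarrow> rep (\<^bold>\<not> y)) = rep (y \<^bold>\<rightarrow> x)"
    by (simp add: rep_eq_iff eqv_def contrapose L4)
qed simp_all

lemma Disj_prelinear: "(\<phi> \<^bold>\<rightarrow> \<psi>) \<^bold>\<or> (\<psi> \<^bold>\<rightarrow> \<phi>) \<in> T"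
  using alg.prelinearity[of \<phi> \<psi>] by (simp add: rep_verum_iff Disj_def)

lemma Disj_commute: "\<phi> \<^bold>\<or> \<psi> \<in> T \<Longrightarrow> \<psi> \<^bold>\<or> \<phi> \<in> T"
  using luk_ax.L3 ax mp by blast

lemma Disj_introL: "\<phi> \<in> T \<Longrightarrow> \<phi> \<^bold>\<or> \<psi> \<in> T"
  unfolding Disj_def by (rule mem_imp_imp)

lemma Disj_mp: "\<phi> \<^bold>\<or> \<chi> \<in> T \<Longrightarrow> (\<phi> \<^bold>\<rightarrow> \<psi>) \<^bold>\<or> \<chi> \<in> T \<Longrightarrow> \<psi> \<^bold>\<or> \<chi> \<in> T"
  using alg.vee_mp[of \<phi> \<chi> \<psi>] by (simp add: rep_verum_iff Disj_def) (blast intro: mp)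

lemma residual_theory: "luk_theory {\<psi>. \<psi> \<^bold>\<or> \<chi> \<in> T}"
  by unfold_locales (auto intro: Disj_mp Disj_introL ax)

end

section \<open>Maximal theories and their linearity\<close>

lemma maximal_theory:
  assumes "luk_theory T" "\<phi> \<notin> T"
  obtains M where "luk_theory M" "T \<subseteq> M" "\<phi> \<notin> M"
    and "\<And>N. luk_theory N \<Longrightarrow> M \<subset> N \<Longrightarrow> \<phi> \<in> N"
proof -
  let ?A = "{M. luk_theory M \<and> T \<subseteq> M \<and> \<phi> \<notin> M}"
  have "\<exists>M\<in>?A. \<forall>N\<in>?A. M \<subseteq> N \<longrightarrow> N = M"
  proof (rule subset_Zorn_nonempty)
    show "?A \<noteq> {}" using assms by blast
    fix C assume "C \<noteq> {}" and C: "subset.chain ?A C"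
    have "luk_theory (\<Union>C)"
    proof
      show "\<psi> \<in> \<Union>C" if "luk_ax \<psi>" for \<psi>
        using that C \<open>C \<noteq> {}\<close> luk_theory.ax by (fastforce simp: subset_chain_def)
      fix \<psi> \<chi> assume "\<psi> \<^bold>\<rightarrow> \<chi> \<in> \<Union>C" "\<psi> \<in> \<Union>C"
      then obtain A B where AB: "A \<in> C" "\<psi> \<^bold>\<rightarrow> \<chi> \<in> A" "B \<in> C" "\<psi> \<in> B" by blast
      then have "A \<subseteq> B \<or> B \<subseteq> A" "luk_theory A" "luk_theory B"
        using C by (auto simp: subset_chain_def)
      then have "\<chi> \<in> A \<union> B"
        using AB luk_theory.mp by blast
      then show "\<chi> \<in> \<Union>C" using AB by blast
    qed
    moreover have "\<forall>M\<in>C. T \<subseteq> M \<and> \<phi> \<notin> M"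
      using C by (auto simp: subset_chain_def)
    ultimately show "\<Union>C \<in> ?A"
      using \<open>C \<noteq> {}\<close> by blast
  qed
  then obtain M where M: "M \<in> ?A" and max: "\<forall>N\<in>?A. M \<subseteq> N \<longrightarrow> N = M" ..
  show thesis
  proof (rule that)
    show "\<phi> \<in> N" if "luk_theory N" "M \<subset> N" for N
      using max[THEN bspec, of N] M that by auto
  qed (use M in auto)
qed

text \<open>If both \<open>\<psi> \<rightarrow> \<chi>\<close> and \<open>\<chi> \<rightarrow> \<psi>\<close> properly extend \<open>M\<close>, the theories \<open>{\<theta>. \<theta> \<or> \<delta> \<in> M}\<close> yield
  \<open>\<phi> \<or> \<phi> \<in> M\<close> without recourse to a deduction theorem.\<close>

lemma maximal_theory_linear:
  assumes "luk_theory M" "\<phi> \<notin> M"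
    and max: "\<And>N. luk_theory N \<Longrightarrow> M \<subset> N \<Longrightarrow> \<phi> \<in> N"
  shows "\<psi> \<^bold>\<rightarrow> \<chi> \<in> M \<or> \<chi> \<^bold>\<rightarrow> \<psi> \<in> M"
proof (rule ccontr)
  interpret luk_theory M by fact
  assume not_mem: "\<not> ?thesis"
  \<comment> \<open>The residual theory of \<open>\<delta>\<close> contains \<open>M\<close> and
    also \<open>\<theta>\<close>, so it extends \<open>M\<close> properly and must contain
    \<open>\<phi>\<close>.\<close>
  have step: "\<phi> \<^bold>\<or> \<delta> \<in> M" if "\<theta> \<^bold>\<or> \<delta> \<in> M" "\<theta> \<notin> M" for \<theta> \<delta>
    using max[OF residual_theory[of \<delta>]] that Disj_introL by blast
  have "\<phi> \<^bold>\<or> (\<chi> \<^bold>\<rightarrow> \<psi>) \<in> M"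
    using step[OF Disj_prelinear] not_mem by blast
  then have "\<phi> \<^bold>\<or> \<phi> \<in> M"
    using step[OF Disj_commute] not_mem by blast
  then have "\<phi> \<in> M"
    unfolding Disj_def using mp refl by blast
  with \<open>\<phi> \<notin> M\<close> show False ..
qed

text \<open>Apart from the range, nothing is asked of formulas \<open>Con c \<phi>\<close>: at this
  level they behave like further variables.\<close>

definition luk_valuation :: "('c fm \<Rightarrow> real) \<Rightarrow> bool" where
  "luk_valuation e \<longleftrightarrow> (\<forall>\<phi>. 0 \<le> e \<phi> \<and> e \<phi> \<le> 1) \<and> (\<forall>\<phi>. e (\<^bold>\<not> \<phi>) = 1 - e \<phi>) \<and>
    (\<forall>\<phi> \<psi>. e (\<phi> \<^bold>\<rightarrow> \<psi>) = min 1 (1 - e \<phi> + e \<psi>))"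

primrec luk_extend :: "('c fm \<Rightarrow> real) \<Rightarrow> 'c fm \<Rightarrow> real" where
  "luk_extend g (Var p) = g (Var p)"
| "luk_extend g (\<^bold>\<not> \<phi>) = 1 - luk_extend g \<phi>"
| "luk_extend g (\<phi> \<^bold>\<rightarrow> \<psi>) = min 1 (1 - luk_extend g \<phi> + luk_extend g \<psi>)"
| "luk_extend g (Con c \<phi>) = g (Con c \<phi>)"

lemma luk_valuation_extend:
  assumes "\<And>\<phi>. 0 \<le> g \<phi> \<and> g \<phi> \<le> 1"
  shows "luk_valuation (luk_extend g)"
proof -
  have "0 \<le> luk_extend g \<phi> \<and> luk_extend g \<phi> \<le> 1" for \<phi>
    by (induction \<phi>) (auto simp: assms)
  then show ?thesis by (simp add: luk_valuation_def)
qed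

primrec subformulas :: "'c fm \<Rightarrow> 'c fm set" where
  "subformulas (Var p) = {Var p}"
| "subformulas (\<^bold>\<not> \<phi>) = insert (\<^bold>\<not> \<phi>) (subformulas \<phi>)"
| "subformulas (\<phi> \<^bold>\<rightarrow> \<psi>) = insert (\<phi> \<^bold>\<rightarrow> \<psi>) (subformulas \<phi> \<union> subformulas \<psi>)"
| "subformulas (Con c \<phi>) = insert (Con c \<phi>) (subformulas \<phi>)"

lemma finite_subformulas: "finite (subformulas \<phi>)"
  by (induction \<phi>) auto

lemma subformulas_refl: "\<phi> \<in> subformulas \<phi>"
  by (cases \<phi>) auto

lemma (in luk_theory) chain_valuation:
  assumes "\<phi> \<notin> T" and linear: "\<And>\<psi> \<chi>. \<psi> \<^bold>\<rightarrow> \<chi> \<in> T \<or> \<chi> \<^bold>\<rightarrow> \<psi> \<in> T" and "finite G"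
  obtains e where "luk_valuation e" "\<And>\<psi>. \<psi> \<in> G \<Longrightarrow> e \<psi> = 1 \<longleftrightarrow> \<psi> \<in> T"
proof -
  interpret wajsberg_chain "\<lambda>\<phi> \<psi>. rep (\<phi> \<^bold>\<rightarrow> \<psi>)" "\<lambda>\<phi>. rep (\<^bold>\<not> \<phi>)" "rep verum"
  proof
    show "rep (\<psi> \<^bold>\<rightarrow> \<chi>) = rep verum \<or> rep (\<chi> \<^bold>\<rightarrow> \<psi>) = rep verum" for \<psi> \<chi>
      by (simp add: rep_verum_iff linear)
    have "\<phi> \<in> T" if "\<^bold>\<not> verum \<in> T"
      using mp[OF mp[OF L4 imp_mem[OF that]] verum] .
    then show "rep (\<^bold>\<not> rep verum) \<noteq> rep verum"
      using \<open>\<phi> \<notin> T\<close> by (auto simp: rep_verum_iff)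
  qed
  define F where "F = (\<Union>\<psi>\<in>G. subformulas \<psi>)"
  have "finite (rep ` F)"
    using \<open>finite G\<close> by (simp add: F_def finite_subformulas)
  from finite_valuation[OF this] obtain e :: "'c fm \<Rightarrow> real" where
    e: "\<And>x. x \<in> rep ` F \<Longrightarrow> 0 \<le> e x \<and> e x \<le> 1"
      "\<And>x. x \<in> rep ` F \<Longrightarrow> e x = 1 \<longleftrightarrow> rep (verum \<^bold>\<rightarrow> x) = rep verum"
      "\<And>x. x \<in> rep ` F \<Longrightarrow> e (rep (\<^bold>\<not> x)) = 1 - e x"
      "\<And>x y. x \<in> rep ` F \<Longrightarrow> y \<in> rep ` F \<Longrightarrow> e (rep (x \<^bold>\<rightarrow> y)) = min 1 (1 - e x + e y)"
    unfolding rep_imp_rep by metis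
  have e01: "0 \<le> e (rep x) \<and> e (rep x) \<le> 1" if "x \<in> F" for x
    using e(1) that by blast
  have e1: "e (rep x) = 1 \<longleftrightarrow> x \<in> T" if "x \<in> F" for x
    using e(2)[of "rep x"] that by (simp add: rep_verum_iff)
  have e_neg: "e (rep (\<^bold>\<not> x)) = 1 - e (rep x)" if "x \<in> F" for x
    using e(3)[of "rep x"] that by simp
  have e_imp: "e (rep (x \<^bold>\<rightarrow> y)) = min 1 (1 - e (rep x) + e (rep y))" if "x \<in> F" "y \<in> F" for x y
    using e(4)[of "rep x" "rep y"] that by simp
  \<comment> \<open>\<open>finite_valuation\<close> controls only finitely many classes. So only its
    values at atoms are kept and the others are recomputed by \<open>luk_extend\<close>; 0 is a
    default outside \<open>F\<close>.\<close>
  define g where "g \<psi> = (if \<psi> \<in> F then e (rep \<psi>) else 0)" for \<psi>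
  have g: "luk_extend g \<psi> = e (rep \<psi>)" if "subformulas \<psi> \<subseteq> F" for \<psi>
    using that
  proof (induction \<psi>)
    case (Imp \<psi> \<chi>)
    then have "\<psi> \<in> F" "\<chi> \<in> F"
      using subformulas_refl by auto
    with Imp show ?case by (simp add: e_imp)
  next
    case (Neg \<psi>)
    then have "\<psi> \<in> F"
      using subformulas_refl by auto
    with Neg show ?case by (simp add: e_neg)
  qed (simp_all add: g_def)
  show thesis
  proof
    show "luk_valuation (luk_extend g)"
      using e01 by (intro luk_valuation_extend) (auto simp: g_def)
    show "luk_extend g \<psi> = 1 \<longleftrightarrow> \<psi> \<in> T" if "\<psi> \<in> G" for \<psi>
    proof -
      have "subformulas \<psi> \<subseteq> F" using that by (auto simp: F_def)
      then show ?thesis using g[of \<psi>] e1[of \<psi>] subformulas_refl[of \<psi>] by auto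
    qed
  qed
qed

text \<open>A maximal theory that omits \<open>\<phi>\<close> gives a chain. Finiteness of
  \<open>\<Gamma>\<close> enters because the chain may have infinitesimals, so that a real valuation
  is available only for a finite set such as \<open>insert \<phi> \<Gamma>\<close>.\<close>

theorem luk_completeness:
  assumes "finite \<Gamma>"
    and valid: "\<And>e. luk_valuation e \<Longrightarrow> (\<And>\<gamma>. \<gamma> \<in> \<Gamma> \<Longrightarrow> e \<gamma> = 1) \<Longrightarrow> e \<phi> = 1"
  shows "derivable (\<lambda>\<psi>. luk_ax \<psi> \<or> \<psi> \<in> \<Gamma>) \<phi>"
proof (rule ccontr)
  let ?T = "{\<psi>. derivable (\<lambda>\<psi>. luk_ax \<psi> \<or> \<psi> \<in> \<Gamma>) \<psi>}"
  assume "\<not> ?thesis"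
  moreover have "luk_theory ?T"
    by unfold_locales (auto intro: derivable.intros)
  ultimately obtain M where M: "luk_theory M" "?T \<subseteq> M" "\<phi> \<notin> M"
    and max: "\<And>N. luk_theory N \<Longrightarrow> M \<subset> N \<Longrightarrow> \<phi> \<in> N"
    using maximal_theory[of ?T \<phi>] by auto
  interpret luk_theory M by fact
  obtain e where "luk_valuation e" and e: "\<And>\<psi>. \<psi> \<in> insert \<phi> \<Gamma> \<Longrightarrow> e \<psi> = 1 \<longleftrightarrow> \<psi> \<in> M"
    using chain_valuation[OF \<open>\<phi> \<notin> M\<close> maximal_theory_linear[OF M(1,3) max], of "insert \<phi> \<Gamma>"]
      \<open>finite \<Gamma>\<close> by auto
  moreover have "\<Gamma> \<subseteq> M"
    using M(2) by (auto intro: derivable.axm)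
  ultimately show False
    using valid[of e] \<open>\<phi> \<notin> M\<close> by auto
qed

section \<open>Standard semantics\<close>

primrec eval :: "('c \<Rightarrow> real \<Rightarrow> real) \<Rightarrow> (nat \<Rightarrow> real) \<Rightarrow> 'c fm \<Rightarrow> real" where
  "eval f v (Var p) = v p"
| "eval f v (\<^bold>\<not> \<phi>) = 1 - eval f v \<phi>"
| "eval f v (\<phi> \<^bold>\<rightarrow> \<psi>) = min 1 (1 - eval f v \<phi> + eval f v \<psi>)"
| "eval f v (Con c \<phi>) = f c (eval f v \<phi>)"

definition valid :: "('c \<Rightarrow> real \<Rightarrow> real) \<Rightarrow> 'c fm \<Rightarrow> bool" where
  "valid f \<phi> \<longleftrightarrow> (\<forall>v. (\<forall>p. 0 \<le> v p \<and> v p \<le> 1) \<longrightarrow> eval f v \<phi> = 1)"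

lemma valid_cong:
  assumes "\<And>v. (\<And>p. 0 \<le> v p \<and> v p \<le> 1) \<Longrightarrow> eval f v \<phi> = eval g v \<psi>"
  shows "valid f \<phi> \<longleftrightarrow> valid g \<psi>"
  using assms by (auto simp: valid_def)

lemma luk_valuationD:
  assumes "luk_valuation e"
  shows "0 \<le> e \<phi>" "e \<phi> \<le> 1" "e (\<^bold>\<not> \<phi>) = 1 - e \<phi>"
    "e (\<phi> \<^bold>\<rightarrow> \<psi>) = min 1 (1 - e \<phi> + e \<psi>)"
  using assms by (auto simp: luk_valuation_def)

lemma luk_valuation_eval:
  assumes "\<And>p. 0 \<le> v p \<and> v p \<le> 1" and f: "\<And>c x. 0 \<le> x \<Longrightarrow> x \<le> 1 \<Longrightarrow> 0 \<le> f c x \<and> f c x \<le> 1"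
  shows "luk_valuation (eval f v)"
proof -
  have "0 \<le> eval f v \<phi> \<and> eval f v \<phi> \<le> 1" for \<phi>
    by (induction \<phi>) (auto simp: assms)
  then show ?thesis by (simp add: luk_valuation_def)
qed

lemma luk_valuation_imp_eq_1: "luk_valuation e \<Longrightarrow> e (\<phi> \<^bold>\<rightarrow> \<psi>) = 1 \<longleftrightarrow> e \<phi> \<le> e \<psi>"
  by (auto simp: luk_valuationD)

lemma luk_ax_sound:
  assumes "luk_ax \<phi>" "luk_valuation e"
  shows "e \<phi> = 1"
  using assms(1)
proof cases
  case (L3 \<phi> \<psi>)
  then show ?thesis
    using luk_valuationD(1,2)[OF assms(2)] by (simp add: Disj_def luk_valuationD(3,4)[OF assms(2)] min_def)
qed (use luk_valuationD(1,2)[OF assms(2)] in \<open>auto simp: luk_valuationD(3,4)[OF assms(2)] min_def\<close>)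

lemma luk_valuation_nsum:
  assumes "luk_valuation e"
  shows "e (nsum k \<theta>) = min 1 (real k * e \<theta>)"
proof (induction k \<theta> rule: nsum.induct)
  case 1
  then show ?case using assms by (simp add: Falsum_def luk_valuationD)
next
  case 2
  then show ?case using luk_valuationD(2)[OF assms] by simp
next
  case (3 k \<theta>)
  then show ?case
    using luk_valuationD(1)[OF assms, of \<theta>]
    by (simp add: Oplus_def luk_valuationD(3,4)[OF assms] algebra_simps min_def)
qed

lemma derivable_weaken:
  assumes "derivable Ax \<phi>" "\<And>\<psi>. Ax \<psi> \<Longrightarrow> derivable Ax' \<psi>"
  shows "derivable Ax' \<phi>"
  using assms(1) by induction (auto intro: assms(2) derivable.mp)

text \<open>Finitely many theorems determine the value of \<open>Con c \<chi>\<close> for each of the finitely many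
  subformulas of \<open>\<phi>\<close>, so that completeness for finite sets of premises applies.\<close>

lemma derivable_iff_valid:
  assumes range: "\<And>c x. 0 \<le> x \<Longrightarrow> x \<le> 1 \<Longrightarrow> 0 \<le> f c x \<and> f c x \<le> 1"
    and luk: "\<And>\<phi>. luk_ax \<phi> \<Longrightarrow> Ax \<phi>"
    and sound: "\<And>\<phi> v. Ax \<phi> \<Longrightarrow> luk_valuation (eval f v) \<Longrightarrow> eval f v \<phi> = 1"
    and forced: "\<And>c \<chi>. \<exists>\<Gamma>. finite \<Gamma> \<and> (\<forall>\<gamma>\<in>\<Gamma>. Ax \<gamma>) \<and>
      (\<forall>e. luk_valuation e \<longrightarrow> (\<forall>\<gamma>\<in>\<Gamma>. e \<gamma> = 1) \<longrightarrow> e (Con c \<chi>) = f c (e \<chi>))"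
  shows "derivable Ax \<phi> \<longleftrightarrow> valid f \<phi>"
proof
  assume "derivable Ax \<phi>"
  show "valid f \<phi>"
    unfolding valid_def
  proof (intro allI impI)
    fix v :: "nat \<Rightarrow> real" assume "\<forall>p. 0 \<le> v p \<and> v p \<le> 1"
    then have e: "luk_valuation (eval f v)"
      using range by (intro luk_valuation_eval) auto
    show "eval f v \<phi> = 1"
      using \<open>derivable Ax \<phi>\<close>
    proof induction
      case (mp \<phi> \<psi>)
      then show ?case
        using luk_valuation_imp_eq_1[OF e, of \<phi> \<psi>] luk_valuationD(2)[OF e, of \<psi>] by linarith
    qed (rule sound[OF _ e])
  qed
next
  assume "valid f \<phi>"
  obtain \<Gamma> where fin: "\<And>c \<chi>. finite (\<Gamma> c \<chi>)" and ax: "\<And>c \<chi> \<gamma>. \<gamma> \<in> \<Gamma> c \<chi> \<Longrightarrow> Ax \<gamma>"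
    and val: "\<And>c \<chi> e. luk_valuation e \<Longrightarrow> (\<forall>\<gamma>\<in>\<Gamma> c \<chi>. e \<gamma> = 1) \<Longrightarrow> e (Con c \<chi>) = f c (e \<chi>)"
    using forced by metis
  define prem where "prem \<psi> = (case \<psi> of Con c \<chi> \<Rightarrow> \<Gamma> c \<chi> | _ \<Rightarrow> {})" for \<psi>
  have "derivable (\<lambda>\<psi>. luk_ax \<psi> \<or> \<psi> \<in> (\<Union>\<psi>\<in>subformulas \<phi>. prem \<psi>)) \<phi>"
  proof (rule luk_completeness)
    show "finite (\<Union>\<psi>\<in>subformulas \<phi>. prem \<psi>)"
      by (auto simp: finite_subformulas fin prem_def split: fm.split)
    fix e assume e: "luk_valuation e" and prem: "\<And>\<gamma>. \<gamma> \<in> (\<Union>\<psi>\<in>subformulas \<phi>. prem \<psi>) \<Longrightarrow> e \<gamma> = 1"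
    define v where "v p = e (Var p)" for p
    \<comment> \<open>The restriction matters: the forcing premises are available only for
      subformulas of \<open>\<phi>\<close>, and elsewhere \<open>e\<close> may differ from
      \<open>eval f v\<close>.\<close>
    have "e \<psi> = eval f v \<psi>" if "subformulas \<psi> \<subseteq> subformulas \<phi>" for \<psi>
      using that
    proof (induction \<psi>)
      case (Con c \<chi>)
      then have "e (Con c \<chi>) = f c (e \<chi>)"
        using prem by (intro val e) (force simp: prem_def)
      with Con show ?case by simp
    qed (simp_all add: v_def luk_valuationD[OF e])
    moreover have "eval f v \<phi> = 1"
      using \<open>valid f \<phi>\<close> luk_valuationD[OF e] by (auto simp: valid_def v_def)
    ultimately show "e \<phi> = 1" by simp
  qed
  moreover have "Ax \<gamma>" if "\<gamma> \<in> prem \<psi>" for \<gamma> \<psi>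
    using that by (cases \<psi>) (auto simp: prem_def intro: ax)
  ultimately show "derivable Ax \<phi>"
    by (elim derivable_weaken) (auto intro: derivable.axm luk)
qed

section \<open>Rational Lukasiewicz logic\<close>

primrec div_interp :: "div_con \<Rightarrow> real \<Rightarrow> real" where
  "div_interp (DivC n) x = x / nat_of_pos n"

lemma nat_of_pos_ge_1: "1 \<le> nat_of_pos n"
  using nat_of_pos[of n] by simp

lemma div_interp_bounds: "0 \<le> x \<Longrightarrow> x \<le> 1 \<Longrightarrow> 0 \<le> div_interp c x \<and> div_interp c x \<le> 1"
  using nat_of_pos_ge_1 by (cases c) (auto simp: divide_le_eq order_trans)

text \<open>(D1) and (D2) fix only the truncated multiple of \<open>Div n \<chi>\<close>, which may
  leave its value open when \<open>\<chi>\<close> has value 1. With \<open>k = n - 1\<close> the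
  bound here removes the truncation. A truncated inner sum would require
  \<open>e \<theta> = 0\<close>, where nothing is truncated.\<close>

lemma D3_eq_1:
  assumes "luk_valuation e"
  shows "e (\<^bold>\<not> \<theta> \<^bold>\<oplus> \<^bold>\<not> nsum k \<theta>) = 1 \<longleftrightarrow> (real k + 1) * e \<theta> \<le> 1"
proof -
  have "e (\<^bold>\<not> \<theta> \<^bold>\<oplus> \<^bold>\<not> nsum k \<theta>) = 1 \<longleftrightarrow> e \<theta> + min 1 (real k * e \<theta>) \<le> 1"
    by (auto simp: Oplus_def luk_valuationD[OF assms] luk_valuation_nsum[OF assms] min_def)
  also have "\<dots> \<longleftrightarrow> (real k + 1) * e \<theta> \<le> 1"
    using luk_valuationD(1,2)[OF assms, of \<theta>] by (cases "e \<theta> = 0") (auto simp: min_def algebra_simps)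
  finally show ?thesis .
qed

lemma rat_theorem_iff_valid: "rat_theorem \<phi> \<longleftrightarrow> valid div_interp \<phi>"
proof (rule derivable_iff_valid)
  show "rat_ax \<phi>" if "luk_ax \<phi>" for \<phi>
    using that by (rule rat_ax.luk)
  show "0 \<le> div_interp c x \<and> div_interp c x \<le> 1" if "0 \<le> x" "x \<le> 1" for c x
    using that by (rule div_interp_bounds)
  show "eval div_interp v \<phi> = 1" if "rat_ax \<phi>" and e: "luk_valuation (eval div_interp v)" for \<phi> v
    using \<open>rat_ax \<phi>\<close>
  proof cases
    case luk
    then show ?thesis using e by (rule luk_ax_sound)
  next
    case (D1 n \<phi>)
    then show ?thesis
      using nat_of_pos_ge_1[of n] luk_valuationD[OF e, of \<phi>] by (simp add: luk_valuation_nsum[OF e])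
  next
    case (D2 \<phi> n)
    then show ?thesis
      using nat_of_pos_ge_1[of n] luk_valuationD[OF e, of \<phi>] by (simp add: luk_valuation_nsum[OF e])
  next
    case (D3 n \<phi>)
    show ?thesis
      unfolding D3 D3_eq_1[OF e]
      using nat_of_pos_ge_1[of n] luk_valuationD[OF e, of \<phi>] by (simp add: of_nat_diff)
  qed
  fix c \<chi>
  obtain n where c: "c = DivC n" by (cases c)
  define d where "d = Div n \<chi>"
  define \<Gamma> where "\<Gamma> = {nsum (nat_of_pos n) d \<^bold>\<rightarrow> \<chi>, \<chi> \<^bold>\<rightarrow> nsum (nat_of_pos n) d,
    \<^bold>\<not> d \<^bold>\<oplus> \<^bold>\<not> nsum (nat_of_pos n - 1) d}"
  have "e d = e \<chi> / nat_of_pos n" if e: "luk_valuation e" and 1: "\<forall>\<gamma>\<in>\<Gamma>. e \<gamma> = 1" for e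
  proof -
    have "min 1 (nat_of_pos n * e d) = e \<chi>"
      using 1 by (auto simp: \<Gamma>_def luk_valuation_imp_eq_1[OF e] luk_valuation_nsum[OF e] intro!: antisym)
    moreover have "nat_of_pos n * e d \<le> 1"
      using 1 nat_of_pos_ge_1[of n] by (simp add: \<Gamma>_def D3_eq_1[OF e] of_nat_diff)
    ultimately show ?thesis
      using nat_of_pos_ge_1[of n] by (simp add: field_simps)
  qed
  moreover have "\<forall>\<gamma>\<in>\<Gamma>. rat_ax \<gamma>"
    unfolding \<Gamma>_def d_def by (auto intro: rat_ax.D1 rat_ax.D2 rat_ax.D3 simp del: One_nat_def)
  ultimately show "\<exists>\<Gamma>. finite \<Gamma> \<and> (\<forall>\<gamma>\<in>\<Gamma>. rat_ax \<gamma>) \<and>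
      (\<forall>e. luk_valuation e \<longrightarrow> (\<forall>\<gamma>\<in>\<Gamma>. e \<gamma> = 1) \<longrightarrow> e (Con c \<chi>) = div_interp c (e \<chi>))"
    by (intro exI[of _ \<Gamma>]) (simp add: c d_def \<Gamma>_def)
qed

section \<open>The logic with the connectives \<open>\<nabla>\<^sub>r\<close>\<close>

definition unit_real :: "unit_rat \<Rightarrow> real" where
  "unit_real r = of_rat (rat_of_unit r)"

lemma unit_real_bounds: "0 \<le> unit_real r" "unit_real r \<le> 1"
  using rat_of_unit[of r] by (auto simp: unit_real_def)

lemma unit_real_simps [simp]:
  "unit_real unit_one = 1"
  "unit_real (unit_times r q) = unit_real r * unit_real q"
  "unit_real (unit_tdiff r q) = max 0 (unit_real r - unit_real q)"
  by (auto simp: unit_real_def unit_one.rep_eq unit_times.rep_eq unit_tdiff.rep_eq of_rat_mult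
      of_rat_diff max_def of_rat_less_eq)

lemma unit_real_recip [simp]: "unit_real (unit_recip n) = 1 / nat_of_pos n"
  by (simp add: unit_real_def unit_recip.rep_eq of_rat_divide)

lemma unit_real_inject: "unit_real r = unit_real q \<longleftrightarrow> r = q"
  by (simp add: unit_real_def rat_of_unit_inject)

primrec nabla_interp :: "nabla_con \<Rightarrow> real \<Rightarrow> real" where
  "nabla_interp (NablaC r) x = 1 - unit_real r * (1 - x)"

text \<open>Truncated differences on the grid \<open>k / n\<close> force the values there to be equidistant.\<close>

lemma Q2_forces_value:
  assumes e: "luk_valuation e"
    and tdiff: "\<And>r q. r \<in> G \<Longrightarrow> q \<in> G \<Longrightarrow> e (Nabla (unit_tdiff r q) \<chi>) = e (Nabla q \<chi> \<^bold>\<rightarrow> Nabla r \<chi>)"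
    and one: "e (Nabla unit_one \<chi>) = e \<chi>"
    and G: "G = {r. \<exists>k\<le>n. unit_real r = real k / real n}" and "0 < n" and "r \<in> G"
  shows "e (Nabla r \<chi>) = 1 - unit_real r * (1 - e \<chi>)"
proof -
  define g where "g k = Unit (of_nat k / of_nat n)" for k
  have g: "unit_real (g k) = real k / real n" if "k \<le> n" for k
    using that \<open>0 < n\<close> by (simp add: g_def unit_real_def Unit_inverse of_rat_divide)
  have gG: "g k \<in> G" if "k \<le> n" for k
    using that g by (auto simp: G)
  \<comment> \<open>In terms of distances from 1 the implication in (Q2) becomes a truncated
    difference, so \<open>d\<close> can be expected to be linear in \<open>k\<close>.\<close>
  define d where "d k = 1 - e (Nabla (g k) \<chi>)" for k
  have diff: "d (k - l) = max 0 (d k - d l)" if "k \<le> n" "l \<le> n" for k l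
  proof -
    have "unit_tdiff (g k) (g l) = g (k - l)"
    proof (cases "l \<le> k")
      case True
      then show ?thesis
        using that by (simp add: unit_real_inject[symmetric] g of_nat_diff diff_divide_distrib
            divide_right_mono)
    next
      case False
      then show ?thesis
        using that by (simp add: unit_real_inject[symmetric] g divide_right_mono)
    qed
    then show ?thesis
      using tdiff[OF gG gG, OF that] by (simp add: d_def luk_valuationD[OF e] min_def max_def)
  qed
  have "d 0 = 0" using diff[of 0 0] by simp
  have step: "d (Suc k) = d k + d 1" if "Suc k \<le> n" for k
  proof -
    \<comment> \<open>The second equation says \<open>d k \<le> d (Suc k)\<close>, so the difference
      in the first is not truncated.\<close>
    have "d 1 = max 0 (d (Suc k) - d k)" "0 = max 0 (d k - d (Suc k))"
      using diff[of "Suc k" k] diff[of k "Suc k"] that \<open>d 0 = 0\<close> by simp_all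
    then show ?thesis by linarith
  qed
  have lin: "d k = real k * d 1" if "k \<le> n" for k
    using that
  proof (induction k)
    case (Suc k)
    then have "d (Suc k) = real k * d 1 + d 1"
      using step[of k] by simp
    then show ?case by (simp add: distrib_right)
  qed (simp add: \<open>d 0 = 0\<close>)
  have "g n = unit_one"
    using \<open>0 < n\<close> by (simp add: unit_real_inject[symmetric] g)
  then have "real n * d 1 = 1 - e \<chi>"
    using lin[of n] one by (simp add: d_def)
  then have d: "d k = real k / real n * (1 - e \<chi>)" if "k \<le> n" for k
    unfolding lin[OF that] using \<open>0 < n\<close> by (simp flip: \<open>real n * d 1 = 1 - e \<chi>\<close>)
  from \<open>r \<in> G\<close> obtain k where "k \<le> n" "unit_real r = real k / real n"
    by (auto simp: G)
  moreover from this have "r = g k"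
    by (simp add: unit_real_inject[symmetric] g)
  ultimately show ?thesis
    using d[of k] by (simp add: d_def)
qed

lemma q_theorem_iff_valid: "q_theorem \<phi> \<longleftrightarrow> valid nabla_interp \<phi>"
proof (rule derivable_iff_valid)
  show "q_ax \<phi>" if "luk_ax \<phi>" for \<phi>
    using that by (rule q_ax.luk)
  show "0 \<le> nabla_interp c x \<and> nabla_interp c x \<le> 1" if "0 \<le> x" "x \<le> 1" for c x
    using that unit_real_bounds by (cases c) (auto simp: mult_le_one)
  show "eval nabla_interp v \<phi> = 1" if "q_ax \<phi>" and e: "luk_valuation (eval nabla_interp v)" for \<phi> v
  proof -
    \<comment> \<open>Soundness of (Q1): the map \<open>x \<mapsto> 1 - r * (1 - x)\<close> is
      affine, monotone and fixes 1, so it commutes with the truncated implication.\<close>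
    have imp: "1 - r * (1 - min 1 (1 - x + y)) = min 1 (1 - (1 - r * (1 - x)) + (1 - r * (1 - y)))"
      if "0 \<le> r" for r x y :: real
    proof (cases "x \<le> y")
      case True
      then have "r * x \<le> r * y" using that by (rule mult_left_mono)
      then show ?thesis using True by (simp add: algebra_simps)
    next
      case False
      then have "r * y \<le> r * x" using that by (intro mult_left_mono) auto
      then show ?thesis using False by (simp add: algebra_simps)
    qed
    have tdiff: "1 - max 0 (r - q) * (1 - x) = min 1 (1 - (1 - q * (1 - x)) + (1 - r * (1 - x)))"
      if "x \<le> 1" for r q x :: real
    proof (cases "r \<le> q")
      case True
      then have "r * (1 - x) \<le> q * (1 - x)" using that by (intro mult_right_mono) auto
      then show ?thesis using True by (simp add: max_def)
    next
      case False
      then have "q * (1 - x) \<le> r * (1 - x)" using that by (intro mult_right_mono) auto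
      then show ?thesis using False by (simp add: max_def left_diff_distrib)
    qed
    note leI = luk_valuation_imp_eq_1[OF e, THEN iffD2]
    show ?thesis
      using \<open>q_ax \<phi>\<close>
    proof cases
      case luk
      then show ?thesis using e by (rule luk_ax_sound)
    next
      case (Q1a r \<phi> \<psi>)
      show ?thesis
        unfolding Q1a by (rule leI) (simp only: eval.simps nabla_interp.simps imp unit_real_bounds)
    next
      case (Q1b r \<phi> \<psi>)
      show ?thesis
        unfolding Q1b by (rule leI) (simp only: eval.simps nabla_interp.simps imp unit_real_bounds)
    next
      case (Q2a r q \<phi>)
      show ?thesis
        unfolding Q2a by (rule leI)
          (simp only: eval.simps nabla_interp.simps unit_real_simps tdiff luk_valuationD(2)[OF e])
    next
      case (Q2b q r \<phi>)
      show ?thesis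
        unfolding Q2b by (rule leI)
          (simp only: eval.simps nabla_interp.simps unit_real_simps tdiff luk_valuationD(2)[OF e])
    qed simp_all
  qed
  fix c \<chi>
  obtain r where c: "c = NablaC r" by (cases c)
  \<comment> \<open>The denominator of \<open>r\<close>, which makes \<open>r\<close> a point of the
    grid of all \<open>k / n\<close>.\<close>
  define n where "n = nat (snd (quotient_of (rat_of_unit r)))"
  have "0 < n"
    using quotient_of_denom_pos' by (simp add: n_def)
  define G where "G = {r. \<exists>k\<le>n. unit_real r = real k / real n}"
  have "finite (unit_real ` G)"
    by (rule finite_subset[of _ "(\<lambda>k. real k / real n) ` {..n}"]) (auto simp: G_def)
  then have "finite G"
    by (rule finite_imageD) (simp add: inj_on_def unit_real_inject)
  have "r \<in> G"
  proof -
    obtain a b where ab: "quotient_of (rat_of_unit r) = (a, b)" by fastforce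
    then have "b > 0" and r: "unit_real r = of_int a / of_int b"
      using quotient_of_denom_pos[OF ab] quotient_of_div[OF ab]
      by (simp_all add: unit_real_def of_rat_divide)
    then have "0 \<le> a" "a \<le> b"
      using unit_real_bounds[of r] by (simp_all add: zero_le_divide_iff)
    then show ?thesis
      using \<open>b > 0\<close> r ab by (auto simp: G_def n_def intro!: exI[of _ "nat a"])
  qed
  define \<Gamma> where "\<Gamma> = {Nabla unit_one \<chi> \<^bold>\<rightarrow> \<chi>, \<chi> \<^bold>\<rightarrow> Nabla unit_one \<chi>} \<union>
    (\<Union>(r, q)\<in>G \<times> G. {Nabla (unit_tdiff r q) \<chi> \<^bold>\<rightarrow> (Nabla q \<chi> \<^bold>\<rightarrow> Nabla r \<chi>),
      (Nabla q \<chi> \<^bold>\<rightarrow> Nabla r \<chi>) \<^bold>\<rightarrow> Nabla (unit_tdiff r q) \<chi>})"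
  have "e (Nabla r \<chi>) = 1 - unit_real r * (1 - e \<chi>)"
    if e: "luk_valuation e" and 1: "\<forall>\<gamma>\<in>\<Gamma>. e \<gamma> = 1" for e
  proof (rule Q2_forces_value[OF e _ _ G_def \<open>0 < n\<close> \<open>r \<in> G\<close>])
    have *: "e \<phi> = e \<psi>" if "\<phi> \<^bold>\<rightarrow> \<psi> \<in> \<Gamma>" "\<psi> \<^bold>\<rightarrow> \<phi> \<in> \<Gamma>" for \<phi> \<psi>
      using 1 that luk_valuation_imp_eq_1[OF e] by (intro antisym) blast+
    show "e (Nabla unit_one \<chi>) = e \<chi>"
      by (rule *) (simp_all add: \<Gamma>_def)
    show "e (Nabla (unit_tdiff r q) \<chi>) = e (Nabla q \<chi> \<^bold>\<rightarrow> Nabla r \<chi>)" if "r \<in> G" "q \<in> G" for r q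
      by (rule *) (use that in \<open>auto simp: \<Gamma>_def\<close>)
  qed
  moreover have "\<forall>\<gamma>\<in>\<Gamma>. q_ax \<gamma>"
    by (auto simp: \<Gamma>_def intro: q_ax.Q2a q_ax.Q2b q_ax.Q4a q_ax.Q4b)
  moreover have "finite \<Gamma>"
    using \<open>finite G\<close> by (auto simp: \<Gamma>_def)
  ultimately show "\<exists>\<Gamma>. finite \<Gamma> \<and> (\<forall>\<gamma>\<in>\<Gamma>. q_ax \<gamma>) \<and>
      (\<forall>e. luk_valuation e \<longrightarrow> (\<forall>\<gamma>\<in>\<Gamma>. e \<gamma> = 1) \<longrightarrow> e (Con c \<chi>) = nabla_interp c (e \<chi>))"
    unfolding c by (intro exI[of _ \<Gamma>]) simp
qed

section \<open>The translations\<close>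

lemma eval_unfold_I1: "eval nabla_interp v (unfold_delta (I1 \<phi>)) = eval div_interp v \<phi>"
proof (induction \<phi>)
  case (Con c \<phi>)
  then show ?case by (cases c) (simp add: Delta_def)
qed simp_all

text \<open>Unfolding after \<open>regard_delta\<close> is not the identity:
  \<open>\<nabla>_r\<close> comes back with a double negation outside and inside. Only the values
  agree.\<close>

lemma eval_unfold_regard: "eval nabla_interp v (unfold_delta (regard_delta \<psi>)) = eval nabla_interp v \<psi>"
proof (induction \<psi>)
  case (Con c \<psi>)
  then show ?case by (cases c) (simp add: Delta_def)
qed simp_all

lemma eval_I2:
  assumes "frac_rep rep" and v: "\<And>p. 0 \<le> v p \<and> v p \<le> 1"
  shows "eval div_interp v (I2 rep \<psi>) = eval nabla_interp v (unfold_delta \<psi>)"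
proof -
  have e: "luk_valuation (eval div_interp v)"
  proof (rule luk_valuation_eval[OF v])
    show "0 \<le> div_interp c x \<and> div_interp c x \<le> 1" if "0 \<le> x" "x \<le> 1" for c x
      using that by (rule div_interp_bounds)
  qed
  show ?thesis
  proof (induction \<psi>)
    case (Con c \<psi>)
    obtain r where c: "c = DeltaC r" by (cases c)
    obtain m n where mn: "rep r = (m, n)" by fastforce
    then have "m \<le> nat_of_pos n" and r: "rat_of_unit r = of_nat m / of_nat (nat_of_pos n)"
      using \<open>frac_rep rep\<close> by (auto simp: frac_rep_def dest: spec[of _ r])
    let ?x = "eval div_interp v (I2 rep \<psi>)"
    \<comment> \<open>Since \<open>m \<le> n\<close>, the sum of \<open>m\<close> copies of
      \<open>x / n\<close> is not truncated; its value \<open>(m / n) * x\<close> is therefore the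
      same for every fractional representation.\<close>
    have "real m * ?x \<le> real (nat_of_pos n) * 1"
      using \<open>m \<le> nat_of_pos n\<close> luk_valuationD(1,2)[OF e] by (intro mult_mono) auto
    then have "real m * (?x / nat_of_pos n) \<le> 1"
      using nat_of_pos_ge_1[of n] by (simp add: field_simps)
    moreover have "unit_real r = m / nat_of_pos n"
      by (simp add: unit_real_def r of_rat_divide)
    ultimately show ?case
      using Con by (simp add: c mn Delta_def luk_valuation_nsum[OF e])
  qed simp_all
qed

theorem theorem2p5:
  fixes rep :: "unit_rat \<Rightarrow> nat \<times> pos_nat"
  assumes "frac_rep rep"
  shows "(\<forall>\<phi> :: rat_fm. rat_theorem \<phi> \<longleftrightarrow> q_theorem (unfold_delta (I1 \<phi>)))
    \<and> (\<forall>\<psi> :: qd_fm. q_theorem (unfold_delta \<psi>) \<longleftrightarrow> rat_theorem (I2 rep \<psi>))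
    \<and> (\<forall>\<psi> :: q_fm. q_theorem \<psi> \<longleftrightarrow> rat_theorem (I2 rep (regard_delta \<psi>)))"
proof (intro conjI allI)
  show "rat_theorem \<phi> \<longleftrightarrow> q_theorem (unfold_delta (I1 \<phi>))" for \<phi>
    unfolding rat_theorem_iff_valid q_theorem_iff_valid by (rule valid_cong) (simp add: eval_unfold_I1)
  show *: "q_theorem (unfold_delta \<psi>) \<longleftrightarrow> rat_theorem (I2 rep \<psi>)" for \<psi>
    unfolding rat_theorem_iff_valid q_theorem_iff_valid by (rule valid_cong) (simp add: eval_I2[OF assms])
  show "q_theorem \<psi> \<longleftrightarrow> rat_theorem (I2 rep (regard_delta \<psi>))" for \<psi>
    unfolding *[symmetric] q_theorem_iff_valid by (rule valid_cong) (simp add: eval_unfold_regard)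
qed

end
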